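(* Let $\alpha\ge 1$ and let $f:\mathbb{R}_+\to\mathbb{R}_+$ be an increasing, smooth, strictly convex function with $f(0)=f'(0)=0$. An $\alpha$-competitive online algorithm for OACC with cost function $f$ exists if and only if there exists a reserve function $\phi:[0,\infty)\to[0,\infty)$ (continuous on $[0,\infty)$, differentiable on $(0,\infty)$) such that $$\phi'(y)=\alpha\cdot\frac{f'(\phi(y))-f'(y)}{\phi(y)\,f''(\phi(y))},\qquad \phi'(y)\ge 0,\qquad \phi(y)\ge y\qquad\text{for all } y>0,\qquad \phi(0)=0 .$$ Moreover, for every such $\phi$ the algorithm PUMax-$\phi$ is $\alpha$-competitive.
   Context: OACC (online allocation with convex costs). There are $m\ge 1$ offline supply nodes, all with the same cost function $f:\mathbb{R}_+\to\mathbb{R}_+$. An instance $I$ is a finite sequence $(\mathbf v_1,\mathbf w_1),\dots,(\mathbf v_T,\mathbf w_T)$ with $\mathbf v_t=(v_{t,j})_{j\in[m]}$, $v_{t,j}\ge 0$, $\mathbf w_t=(w_{t,j})_{j\in[m]}$, $w_{t,j}>0$. When demand $t$ arrives, an irrevocable allocation $\mathbf x_t\in\mathcal X=\{\mathbf x\in\mathbb{R}_+^m:\sum_j x_j\le 1\}$ must be chosen. The objective is $\sum_{t}\sum_j v_{t,j}x_{t,j}-\sum_j f\big(\sum_t w_{t,j}x_{t,j}\big)$. $\mathrm{OPT}(I)$ is the offline maximum of the objective; $\mathrm{ALG}(I)$ is the value obtained by an online algorithm, i.e. one in which $\mathbf x_t$ depends only on $f$, $m$ and the first $t$ arrivals ($T$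 is unknown). An online algorithm is $\alpha$-competitive if $\mathrm{OPT}(I)\le\alpha\,\mathrm{ALG}(I)$ for every instance $I$. PUMax-$\phi$ (pseudo-utility maximization): start with $y_{0,j}=0$ for all $j$; upon arrival of demand $t$ choose $\mathbf x_t\in\arg\max_{\mathbf x\in\mathcal X}\ \sum_j v_{t,j}x_j-\sum_j\int_{y_{t-1,j}}^{y_{t-1,j}+w_{t,j}x_j}f'(\phi(\eta))\,d\eta$ and set $y_{t,j}=y_{t-1,j}+w_{t,j}x_{t,j}$.
   Formalization: The formal statement additionally assumes f''(x) > 0 for all x > 0. Strict convexity alone allows f''(c) = 0 at some c > 0; every reserve function φ attains the value c, so the differential equation would divide by zero there and the equivalence can fail. *)

theory Defs
  imports "HOL-Analysis.Analysis"
begin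

text \<open>
  Cost functions live on \<open>[0, \<infinity>)\<close> but have type \<^typ>\<open>real \<Rightarrow> real\<close>. Their derivative is taken
  within \<^term>\<open>{0..} :: real set\<close>, so that it is one-sided at 0 and independent of the values at
  negative arguments.
\<close>

definition deriv_nonneg :: "(real \<Rightarrow> real) \<Rightarrow> real \<Rightarrow> real" where
  "deriv_nonneg f x = vector_derivative f (at x within {0..})"

text \<open>
  Differentiable on \<open>[0, \<infinity>)\<close> and infinitely differentiable on \<open>(0, \<infinity>)\<close>; higher derivatives
  may blow up at 0, as they do for \<open>f y = y powr s\<close> with \<open>1 < s < 2\<close>.
\<close>

definition smooth_cost :: "(real \<Rightarrow> real) \<Rightarrow> bool" where
  "smooth_cost f \<longleftrightarrow>
     f differentiable_on {0..} \<and> (\<forall>n. (deriv_nonneg ^^ n) f differentiable_on {0<..})"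

definition strictly_convex_on :: "real set \<Rightarrow> (real \<Rightarrow> real) \<Rightarrow> bool" where
  "strictly_convex_on S f \<longleftrightarrow> convex S \<and>
     (\<forall>x\<in>S. \<forall>y\<in>S. \<forall>t. x \<noteq> y \<longrightarrow> 0 < t \<longrightarrow> t < 1 \<longrightarrow>
        f ((1 - t) * x + t * y) < (1 - t) * f x + t * f y)"

text \<open>
  The supply nodes are the elements of the finite type \<^typ>\<open>'m::finite\<close>. An arrival is a pair
  \<open>(v\<^sub>t, w\<^sub>t)\<close> and an instance is a list of arrivals, indexed from 0.
\<close>

type_synonym 'm arrival = "(real ^ 'm) \<times> (real ^ 'm)"

definition valid_instance :: "'m::finite arrival list \<Rightarrow> bool" where
  "valid_instance I \<longleftrightarrow> (\<forall>(v, w)\<in>set I. \<forall>j. v $ j \<ge> 0 \<and> w $ j > 0)"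

definition allocations :: "(real ^ 'm::finite) set" where
  "allocations = {x. (\<forall>j. x $ j \<ge> 0) \<and> (\<Sum>j\<in>UNIV. x $ j) \<le> 1}"

definition objective ::
  "(real \<Rightarrow> real) \<Rightarrow> 'm::finite arrival list \<Rightarrow> (nat \<Rightarrow> real ^ 'm) \<Rightarrow> real" where
  "objective f I x =
     (\<Sum>t<length I. \<Sum>j\<in>UNIV. fst (I ! t) $ j * x t $ j)
     - (\<Sum>j\<in>UNIV. f (\<Sum>t<length I. snd (I ! t) $ j * x t $ j))"

definition OPT :: "(real \<Rightarrow> real) \<Rightarrow> 'm::finite arrival list \<Rightarrow> real" where
  "OPT f I = (SUP x\<in>{x. \<forall>t<length I. x t \<in> allocations}. objective f I x)"

text \<open>
  An online algorithm maps the nonempty list of arrivals seen so far to the allocation of the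
  latest one. Since it is a function of this list alone, it knows neither the future arrivals
  nor \<open>T\<close>.
\<close>

definition online_algorithm :: "('m::finite arrival list \<Rightarrow> real ^ 'm) \<Rightarrow> bool" where
  "online_algorithm A \<longleftrightarrow> (\<forall>I. valid_instance I \<longrightarrow> I \<noteq> [] \<longrightarrow> A I \<in> allocations)"

definition run ::
  "('m::finite arrival list \<Rightarrow> real ^ 'm) \<Rightarrow> 'm arrival list \<Rightarrow> nat \<Rightarrow> real ^ 'm" where
  "run A I t = A (take (Suc t) I)"

definition ALG ::
  "(real \<Rightarrow> real) \<Rightarrow> ('m::finite arrival list \<Rightarrow> real ^ 'm) \<Rightarrow> 'm arrival list \<Rightarrow> real" where
  "ALG f A I = objective f I (run A I)"

definition competitive ::
  "real \<Rightarrow> (real \<Rightarrow> real) \<Rightarrow> ('m::finite arrival list \<Rightarrow> real ^ 'm) \<Rightarrow> bool" where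
  "competitive \<alpha> f A \<longleftrightarrow>
     online_algorithm A \<and> (\<forall>I. valid_instance I \<longrightarrow> OPT f I \<le> \<alpha> * ALG f A I)"

text \<open>\<open>load A I t\<close> is the vector of node loads after the first \<open>t\<close> arrivals of \<open>I\<close>.\<close>

primrec load ::
  "('m::finite arrival list \<Rightarrow> real ^ 'm) \<Rightarrow> 'm arrival list \<Rightarrow> nat \<Rightarrow> real ^ 'm" where
  "load A I 0 = 0"
| "load A I (Suc t) = (\<chi> j. load A I t $ j + snd (I ! t) $ j * run A I t $ j)"

definition pseudo_utility ::
  "(real \<Rightarrow> real) \<Rightarrow> (real \<Rightarrow> real) \<Rightarrow> real ^ 'm::finite \<Rightarrow> 'm arrival \<Rightarrow> real ^ 'm \<Rightarrow> real" where
  "pseudo_utility f \<phi> y = (\<lambda>(v, w) x.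
     (\<Sum>j\<in>UNIV. v $ j * x $ j)
     - (\<Sum>j\<in>UNIV. integral {y $ j .. y $ j + w $ j * x $ j} (\<lambda>\<eta>. deriv_nonneg f (\<phi> \<eta>))))"

text \<open>
  PUMax leaves ties in the maximization open, so it is a property of algorithms: every choice
  the algorithm makes is some maximizer of the pseudo-utility.
\<close>

definition is_PUMax ::
  "(real \<Rightarrow> real) \<Rightarrow> (real \<Rightarrow> real) \<Rightarrow> ('m::finite arrival list \<Rightarrow> real ^ 'm) \<Rightarrow> bool" where
  "is_PUMax f \<phi> A \<longleftrightarrow>
     (\<forall>I. valid_instance I \<longrightarrow> (\<forall>t<length I.
        is_arg_max (pseudo_utility f \<phi> (load A I t) (I ! t)) (\<lambda>x. x \<in> allocations) (run A I t)))"

definition reserve_function :: "real \<Rightarrow> (real \<Rightarrow> real) \<Rightarrow> (real \<Rightarrow> real) \<Rightarrow> bool" where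
  "reserve_function \<alpha> f \<phi> \<longleftrightarrow>
     (\<forall>y\<ge>0. \<phi> y \<ge> 0) \<and> continuous_on {0..} \<phi> \<and> \<phi> differentiable_on {0<..} \<and> \<phi> 0 = 0 \<and>
     (\<forall>y>0.
        deriv \<phi> y = \<alpha> * ((deriv_nonneg f (\<phi> y) - deriv_nonneg f y)
                      / (\<phi> y * deriv_nonneg (deriv_nonneg f) (\<phi> y))) \<and>
        deriv \<phi> y \<ge> 0 \<and> \<phi> y \<ge> y)"

end

theory Submission
  imports Defs
begin

text \<open>
  Let \<open>g q = q f' q - f q\<close> be the conjugate of \<open>f\<close> at \<open>f' q\<close> (called \<open>leg\<close> below). Since \<open>g' q = q f'' q\<close>, the reserve
  equation is \<open>(g \<circ> \<phi>)' = \<alpha> (f' \<circ> \<phi> - f')\<close>; integrated, it reads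
  \<open>\<alpha> (\<integral>\<^sub>0\<^sup>y f' (\<phi> \<eta>) d\<eta> - f y) = g (\<phi> y)\<close>.

  Sufficiency is weak duality with the dual prices \<open>p\<^sub>j = f' (\<phi> (y\<^sub>j))\<close> at the final loads \<open>y\<^sub>j\<close>: the
  first-order conditions of the pseudo-utility maximizations bound the dual objective, and the
  integrated equation compares \<open>g (\<phi> (y\<^sub>j))\<close> with \<open>\<alpha>\<close> times the surplus earned on node \<open>j\<close>.

  For necessity, \<open>u = g \<circ> \<phi>\<close> solves \<open>u' = \<alpha> (f' \<circ> g\<^sup>-\<^sup>1 \<circ> u - f')\<close>. For each \<open>n\<close>, solve this equation
  backwards from \<open>u n = g n\<close>, that is from \<open>\<phi> n = n\<close>. The solutions stay above \<open>g\<close> and increase with \<open>n\<close>.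
  If one of them had \<open>u 0 > 0\<close>, then a finite sequence of slowly increasing prices up to \<open>f' n\<close> would
  defeat every algorithm. Hence all start at \<open>0\<close>, are bounded locally uniformly in \<open>n\<close>, and converge
  to \<open>g \<circ> \<phi>\<close> for a reserve function \<open>\<phi>\<close>. Starting from the diagonal matters when \<open>f'\<close> is bounded:
  other solutions of the equation may then blow up at a finite load.
\<close>

subsection \<open>The cost function and its conjugate\<close>

locale convex_cost =
  fixes f :: "real \<Rightarrow> real"
  assumes f_nonneg: "0 \<le> x \<Longrightarrow> 0 \<le> f x"
    and f_deriv: "0 \<le> x \<Longrightarrow> (f has_real_derivative deriv_nonneg f x) (at x within {0..})"
    and d_deriv: "0 < x \<Longrightarrow>
      (deriv_nonneg f has_real_derivative deriv_nonneg (deriv_nonneg f) x) (at x)"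
    and d2_pos: "0 < x \<Longrightarrow> 0 < deriv_nonneg (deriv_nonneg f) x"
    and f_0: "f 0 = 0" and d_0: "deriv_nonneg f 0 = 0"
begin

abbreviation d :: "real \<Rightarrow> real" where "d \<equiv> deriv_nonneg f"
abbreviation d2 :: "real \<Rightarrow> real" where "d2 \<equiv> deriv_nonneg d"

lemma f_deriv_at: "0 < x \<Longrightarrow> (f has_real_derivative d x) (at x)"
  using f_deriv[of x] by (simp add: at_within_interior[of x "{0..}"])

lemma continuous_on_f: "continuous_on {0..} f"
  using f_deriv by (auto simp: continuous_on_eq_continuous_within intro: DERIV_continuous)

lemma f_mean_value:
  assumes "0 \<le> a" "a < b"
  obtains z where "a < z" "z < b" "f b - f a = (b - a) * d z"
proof -
  have "\<exists>l z. a < z \<and> z < b \<and> DERIV f z :> l \<and> f b - f a = (b - a) * l"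
  proof (rule MVT)
    show "continuous_on {a..b} f"
      using assms by (intro continuous_on_subset[OF continuous_on_f]) auto
  next
    fix x assume "a < x" "x < b"
    then show "f differentiable (at x)"
      using f_deriv_at[of x] assms by (auto simp: real_differentiable_def)
  qed (use assms in auto)
  then obtain l z where "a < z" "z < b" "DERIV f z :> l" "f b - f a = (b - a) * l" by blast
  moreover from this have "l = d z"
    using DERIV_unique[OF _ f_deriv_at[of z]] assms by simp
  ultimately show thesis by (intro that[of z]) auto
qed

text \<open>Positivity of \<open>d2\<close> settles positive arguments. At 0 the mean value theorem
  and nonnegativity of \<open>f\<close> give some \<open>z\<close> below \<open>y\<close> with
  \<open>d z \<ge> 0\<close>.\<close>

lemma d_strict_mono:
  assumes "0 \<le> x" "x < y"
  shows "d x < d y"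
proof -
  have pos: "d a < d b" if "0 < a" "a < b" for a b
  proof (rule DERIV_pos_imp_increasing[of a b d])
    fix x assume "a \<le> x" "x \<le> b"
    then show "\<exists>y. (d has_real_derivative y) (at x) \<and> 0 < y"
      using that d_deriv[of x] d2_pos[of x] by auto
  qed (use that in auto)
  show ?thesis
  proof (cases "x = 0")
    case True
    obtain z where z: "0 < z" "z < y" "f y - f 0 = (y - 0) * d z"
      using f_mean_value[of 0 y] assms by auto
    have "0 \<le> d z"
      using z f_nonneg[of y] f_0 by (simp add: zero_le_mult_iff)
    with pos[of z y] z True d_0 show ?thesis by simp
  next
    case False
    then show ?thesis using pos[of x y] assms by simp
  qed
qed

lemma d_mono: "0 \<le> x \<Longrightarrow> x \<le> y \<Longrightarrow> d x \<le> d y"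
  using d_strict_mono[of x y] by (cases "x = y") auto

lemma d_nonneg: "0 \<le> x \<Longrightarrow> 0 \<le> d x"
  using d_mono[of 0 x] d_0 by simp

text \<open>Only continuity at 0 needs an argument: monotonicity of \<open>d\<close> gives
  \<open>x * d x \<le> f (2 * x)\<close>, which squeezes \<open>d x\<close> between 0 and
  \<open>f (2 * x) / x\<close>, and this tends to \<open>2 * d 0 = 0\<close>.\<close>

lemma continuous_on_d: "continuous_on {0..} d"
proof -
  have "continuous (at x within {0..}) d" if "0 \<le> x" for x
  proof (cases "x = 0")
    case False
    then show ?thesis
      using d_deriv[of x] that by (auto intro: DERIV_continuous continuous_at_imp_continuous_within)
  next
    case True
    have "((\<lambda>y. (f y - f 0) / (y - 0)) \<longlongrightarrow> d 0) (at 0 within {0..})"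
      using f_deriv[of 0] by (simp add: has_field_derivative_iff)
    then have lim: "((\<lambda>y. f y / y) \<longlongrightarrow> 0) (at_right 0)"
      by (simp add: f_0 d_0 at_within_Ici_at_right)
    have "filterlim (\<lambda>x. 2 * x :: real) (at_right 0) (at_right 0)"
      by (auto simp: filterlim_at eventually_at_right_less intro!: tendsto_eq_intros
          eventually_mono[OF eventually_at_right_less])
    from filterlim_compose[OF lim this]
    have "((\<lambda>x. 2 * (f (2 * x) / (2 * x))) \<longlongrightarrow> 2 * 0) (at_right 0)"
      by (intro tendsto_mult tendsto_const)
    then have lim2: "((\<lambda>x. f (2 * x) / x) \<longlongrightarrow> 0) (at_right 0)" by simp
    have "(d \<longlongrightarrow> 0) (at_right 0)"
    proof (rule tendsto_sandwich[OF _ _ tendsto_const lim2])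
      show "\<forall>\<^sub>F x in at_right 0. 0 \<le> d x"
        using eventually_at_right_less by (rule eventually_mono) (auto intro: d_nonneg)
      show "\<forall>\<^sub>F x in at_right 0. d x \<le> f (2 * x) / x"
        using eventually_at_right_less
      proof (rule eventually_mono)
        fix x :: real assume x: "0 < x"
        obtain z where z: "x < z" "z < 2 * x" "f (2 * x) - f x = (2 * x - x) * d z"
          using f_mean_value[of x "2 * x"] x by auto
        have "x * d x \<le> x * d z" using d_mono[of x z] x z by simp
        also have "\<dots> \<le> f (2 * x)" using z f_nonneg[of x] x by simp
        finally show "d x \<le> f (2 * x) / x" using x by (simp add: field_simps)
      qed
    qed
    then show ?thesis
      using True d_0 by (simp add: continuous_within at_within_Ici_at_right)
  qed
  then show ?thesis by (auto simp: continuous_on_eq_continuous_within)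
qed

lemma f_above_tangent:
  assumes "0 \<le> x" "0 \<le> y"
  shows "f x + d x * (y - x) \<le> f y"
proof (cases x y rule: linorder_cases)
  case less
  then obtain z where z: "x < z" "z < y" "f y - f x = (y - x) * d z"
    using f_mean_value assms by blast
  have "(y - x) * d x \<le> (y - x) * d z" using d_mono[of x z] z assms by simp
  with z show ?thesis by (simp add: algebra_simps)
next
  case greater
  then obtain z where z: "y < z" "z < x" "f x - f y = (x - y) * d z"
    using f_mean_value assms by blast
  have "(x - y) * d z \<le> (x - y) * d x" using d_mono[of z x] z assms by simp
  with z show ?thesis by (simp add: algebra_simps)
qed simp

text \<open>The Legendre transform: the convex conjugate of \<open>f\<close>, evaluated at slope \<open>d q\<close>.\<close>

definition leg :: "real \<Rightarrow> real" where
  "leg q = q * d q - f q"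

lemma leg_0 [simp]: "leg 0 = 0"
  by (simp add: leg_def f_0)

text \<open>The tangent to \<open>f\<close> at \<open>y\<close>, evaluated at \<open>x\<close>. This
  is an integrated form of \<open>leg' q = q * d2 q\<close> that avoids \<open>d2\<close> and so
  includes \<open>x = 0\<close>.\<close>

lemma leg_growth:
  assumes "0 \<le> x" "x \<le> y"
  shows "x * (d y - d x) \<le> leg y - leg x"
proof -
  have "f y + d y * (x - y) \<le> f x" using assms by (intro f_above_tangent) auto
  then show ?thesis by (simp add: leg_def algebra_simps)
qed

lemma leg_strict_mono:
  assumes "0 \<le> x" "x < y"
  shows "leg x < leg y"
proof -
  \<comment> \<open>From \<open>x = 0\<close>, \<open>leg_growth\<close> gives no strict increase;
    from the positive midpoint it does.\<close>
  define z where "z = (x + y) / 2"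
  have z: "x < z" "z < y" "0 < z" using assms by (auto simp: z_def)
  have "0 \<le> x * (d z - d x)" using d_mono[of x z] z assms by simp
  moreover have "0 < z * (d y - d z)" using d_strict_mono[of z y] z by simp
  ultimately show ?thesis
    using leg_growth[of x z] leg_growth[of z y] z assms by linarith
qed

lemma leg_mono: "0 \<le> x \<Longrightarrow> x \<le> y \<Longrightarrow> leg x \<le> leg y"
  using leg_strict_mono[of x y] by (cases "x = y") auto

lemma leg_le_iff: "0 \<le> x \<Longrightarrow> 0 \<le> y \<Longrightarrow> leg x \<le> leg y \<longleftrightarrow> x \<le> y"
  using leg_strict_mono[of y x] leg_mono[of x y] by force

lemma leg_less_iff: "0 \<le> x \<Longrightarrow> 0 \<le> y \<Longrightarrow> leg x < leg y \<longleftrightarrow> x < y"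
  using leg_le_iff[of y x] by force

lemma leg_nonneg: "0 \<le> x \<Longrightarrow> 0 \<le> leg x"
  using leg_mono[of 0 x] by simp

lemma continuous_on_leg: "continuous_on {0..} leg"
  unfolding leg_def by (intro continuous_intros continuous_on_d continuous_on_f)

lemma leg_deriv:
  assumes "0 < q"
  shows "(leg has_real_derivative q * d2 q) (at q)"
  unfolding leg_def
  using d_deriv[OF assms] f_deriv_at[OF assms]
  by (auto intro!: derivative_eq_intros)

text \<open>As a function of \<open>leg q\<close>, the price \<open>d q\<close> has slope
  \<open>1 / q\<close>, so it is Lipschitz away from 0. This makes the reserve equation Lipschitz in
  \<open>leg \<circ> \<phi>\<close> and turns convergence of \<open>leg\<close> values into
  convergence of prices.\<close>

lemma d_lipschitz:
  assumes "0 < a" "a \<le> x" "a \<le> y"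
  shows "a * \<bar>d x - d y\<bar> \<le> \<bar>leg x - leg y\<bar>"
proof -
  have "a * \<bar>d x - d y\<bar> \<le> \<bar>leg x - leg y\<bar>" if "a \<le> x" "x \<le> y" for x y
  proof -
    have "a * (d y - d x) \<le> x * (d y - d x)"
      using d_mono[of x y] that assms by (intro mult_right_mono) auto
    also have "\<dots> \<le> leg y - leg x" using leg_growth that assms by simp
    finally show ?thesis using d_mono[of x y] leg_mono[of x y] that assms by simp
  qed
  from this[of x y] this[of y x] assms show ?thesis
    by (cases "x \<le> y") (auto simp: abs_minus_commute)
qed

end

subsection \<open>Pseudo-utility maximization\<close>

lemma allocations_0 [simp]: "0 \<in> allocations"
  by (simp add: allocations_def)

lemma allocations_nonneg: "x \<in> allocations \<Longrightarrow> 0 \<le> x $ j"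
  by (simp add: allocations_def)

lemma allocations_le_1: "x \<in> allocations \<Longrightarrow> x $ j \<le> 1"
  using member_le_sum[of j UNIV "\<lambda>j. x $ j"] by (fastforce simp: allocations_def)

lemma convex_allocations: "convex (allocations :: (real ^ 'm::finite) set)"
proof (rule convexI)
  fix x y :: "real ^ 'm" and u v :: real
  assume *: "x \<in> allocations" "y \<in> allocations" "0 \<le> u" "0 \<le> v" "u + v = 1"
  have "(\<Sum>j\<in>UNIV. u * x $ j + v * y $ j) \<le> u * 1 + v * 1"
    using * unfolding sum.distrib sum_distrib_left[symmetric] allocations_def
    by (intro add_mono mult_left_mono) auto
  with * show "u *\<^sub>R x + v *\<^sub>R y \<in> allocations"
    by (simp add: allocations_def)
qed

lemma compact_allocations: "compact (allocations :: (real ^ 'm::finite) set)"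
proof -
  have "allocations =
      (\<Inter>j. {x :: real ^ 'm. 0 \<le> x $ j}) \<inter> {x. (\<Sum>j\<in>UNIV. x $ j) \<le> 1}"
    by (auto simp: allocations_def)
  moreover have "closed \<dots>"
    by (intro closed_Int closed_INT ballI closed_Collect_le continuous_intros)
  moreover have "norm x \<le> real CARD('m)" if "x \<in> allocations" for x :: "real ^ 'm"
  proof -
    have "norm x \<le> (\<Sum>j\<in>UNIV. \<bar>x $ j\<bar>)" by (rule norm_le_l1_cart)
    also have "\<dots> \<le> (\<Sum>j\<in>(UNIV :: 'm set). 1)"
      using that by (intro sum_mono) (simp add: allocations_nonneg allocations_le_1)
    finally show ?thesis by simp
  qed
  ultimately show ?thesis
    by (auto simp: compact_eq_bounded_closed bounded_iff)
qed

lemma valid_instanceD: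
  assumes "valid_instance I" "t < length I"
  shows "0 \<le> fst (I ! t) $ j" "0 < snd (I ! t) $ j"
  using assms nth_mem[of t I] by (auto simp: valid_instance_def case_prod_beta)

lemma load_eq_sum: "load A I t $ j = (\<Sum>s<t. snd (I ! s) $ j * run A I s $ j)"
  by (induction t) auto

lemma load_mono:
  assumes "valid_instance I" "\<And>t. t < length I \<Longrightarrow> run A I t \<in> allocations"
    and "s \<le> t" "t \<le> length I"
  shows "load A I s $ j \<le> load A I t $ j"
  unfolding load_eq_sum using assms
  by (intro sum_mono2) (auto simp: allocations_nonneg valid_instanceD less_imp_le)

locale reserve = convex_cost +
  fixes \<alpha> :: real and \<phi> :: "real \<Rightarrow> real"
  assumes \<alpha>_ge_1: "1 \<le> \<alpha>"
    and \<phi>_reserve: "reserve_function \<alpha> f \<phi>"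
begin

lemma \<phi>_0: "\<phi> 0 = 0"
  using \<phi>_reserve by (simp add: reserve_function_def)

lemma \<phi>_nonneg: "0 \<le> y \<Longrightarrow> 0 \<le> \<phi> y"
  using \<phi>_reserve by (simp add: reserve_function_def)

lemma \<phi>_pos: "0 < y \<Longrightarrow> 0 < \<phi> y"
  using \<phi>_reserve by (force simp: reserve_function_def)

lemma continuous_on_\<phi>: "continuous_on {0..} \<phi>"
  using \<phi>_reserve by (simp add: reserve_function_def)

lemma \<phi>_deriv:
  assumes "0 < y"
  shows "(\<phi> has_real_derivative \<alpha> * ((d (\<phi> y) - d y) / (\<phi> y * d2 (\<phi> y)))) (at y)"
proof -
  have "\<phi> differentiable (at y within {0<..})"
    using \<phi>_reserve assms by (simp add: reserve_function_def differentiable_on_def)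
  then have "\<phi> differentiable (at y)"
    using assms at_within_open[of y "{0<..}"] by simp
  then have "(\<phi> has_real_derivative deriv \<phi> y) (at y)"
    by (simp add: DERIV_deriv_iff_real_differentiable)
  with \<phi>_reserve assms show ?thesis by (simp add: reserve_function_def)
qed

lemma \<phi>_mono:
  assumes "0 \<le> x" "x \<le> y"
  shows "\<phi> x \<le> \<phi> y"
proof (cases "x = y")
  case False
  show ?thesis
  proof (rule DERIV_nonneg_imp_increasing_open[of x y \<phi>])
    fix z assume "x < z" "z < y"
    then have z: "0 < z" using assms by simp
    have "0 \<le> \<alpha> * ((d (\<phi> z) - d z) / (\<phi> z * d2 (\<phi> z)))"
      using \<phi>_reserve z unfolding reserve_function_def by metis
    then show "\<exists>l. (\<phi> has_real_derivative l) (at z) \<and> 0 \<le> l"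
      using \<phi>_deriv[OF z] by blast
  qed (use assms continuous_on_subset[OF continuous_on_\<phi>, of "{x..y}"] in auto)
qed simp

lemma continuous_on_price: "continuous_on {0..} (\<lambda>y. d (\<phi> y))"
  by (rule continuous_on_compose2[OF continuous_on_d continuous_on_\<phi>]) (auto intro: \<phi>_nonneg)

lemma price_mono: "0 \<le> x \<Longrightarrow> x \<le> y \<Longrightarrow> d (\<phi> x) \<le> d (\<phi> y)"
  by (intro d_mono \<phi>_nonneg \<phi>_mono)

text \<open>
  The reserve equation says exactly that the pseudo-cost \<open>\<integral>\<^sub>0\<^sup>y f' (\<phi> \<eta>) d\<eta>\<close> has this closed form.
\<close>

definition pseudo_cost :: "real \<Rightarrow> real" where
  "pseudo_cost y = leg (\<phi> y) / \<alpha> + f y"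

lemma pseudo_cost_0: "pseudo_cost 0 = 0"
  by (simp add: pseudo_cost_def \<phi>_0 f_0)

lemma continuous_on_pseudo_cost: "continuous_on {0..} pseudo_cost"
  unfolding pseudo_cost_def
  by (intro continuous_intros continuous_on_f continuous_on_compose2[OF continuous_on_leg continuous_on_\<phi>])
     (use \<alpha>_ge_1 \<phi>_nonneg in auto)

text \<open>The derivative \<open>q * d2 q\<close> of \<open>leg\<close> at
  \<open>q = \<phi> y\<close> cancels the denominator of the reserve equation.\<close>

lemma pseudo_cost_deriv:
  assumes "0 < y"
  shows "(pseudo_cost has_real_derivative d (\<phi> y)) (at y)"
proof -
  have "\<phi> y * d2 (\<phi> y) \<noteq> 0"
    using \<phi>_pos[OF assms] d2_pos[of "\<phi> y"] by simp
  then have "(\<phi> y * d2 (\<phi> y)) * (\<alpha> * ((d (\<phi> y) - d y) / (\<phi> y * d2 (\<phi> y)))) / \<alpha> + d y = d (\<phi> y)"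
    using \<alpha>_ge_1 by (simp add: field_simps)
  moreover have "((\<lambda>y. leg (\<phi> y)) has_real_derivative
      (\<phi> y * d2 (\<phi> y)) * (\<alpha> * ((d (\<phi> y) - d y) / (\<phi> y * d2 (\<phi> y))))) (at y)"
    by (rule DERIV_chain2[OF leg_deriv[OF \<phi>_pos[OF assms]] \<phi>_deriv[OF assms]])
  from DERIV_add[OF DERIV_cdivide[OF this, of \<alpha>] f_deriv_at[OF assms]]
  have "(pseudo_cost has_real_derivative (\<phi> y * d2 (\<phi> y)) *
      (\<alpha> * ((d (\<phi> y) - d y) / (\<phi> y * d2 (\<phi> y)))) / \<alpha> + d y) (at y)"
    unfolding pseudo_cost_def .
  ultimately show ?thesis by (simp only:)
qed

lemma integral_price:
  assumes "0 \<le> a" "a \<le> b"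
  shows "integral {a..b} (\<lambda>y. d (\<phi> y)) = pseudo_cost b - pseudo_cost a"
proof (intro integral_unique fundamental_theorem_of_calculus_interior)
  show "continuous_on {a..b} pseudo_cost"
    using assms by (intro continuous_on_subset[OF continuous_on_pseudo_cost]) auto
qed (use assms pseudo_cost_deriv in \<open>auto simp: has_real_derivative_iff_has_vector_derivative\<close>)

text \<open>Prices are nondecreasing, so \<open>pseudo_cost\<close> is convex; this is its tangent
  inequality at the new load \<open>y\<close>.\<close>

lemma pseudo_cost_diff_le:
  assumes "0 \<le> x" "0 \<le> y"
  shows "pseudo_cost y - pseudo_cost x \<le> d (\<phi> y) * (y - x)"
proof -
  have mvt: "\<exists>z. a < z \<and> z < b \<and> pseudo_cost b - pseudo_cost a = (b - a) * d (\<phi> z)"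
    if "0 \<le> a" "a < b" for a b
  proof -
    have "\<exists>l z. a < z \<and> z < b \<and> DERIV pseudo_cost z :> l \<and>
        pseudo_cost b - pseudo_cost a = (b - a) * l"
    proof (rule MVT)
      show "continuous_on {a..b} pseudo_cost"
        using that by (intro continuous_on_subset[OF continuous_on_pseudo_cost]) auto
    next
      fix x assume "a < x" "x < b"
      then show "pseudo_cost differentiable (at x)"
        using pseudo_cost_deriv[of x] that by (auto simp: real_differentiable_def)
    qed (use that in auto)
    then obtain l z where z: "a < z" "z < b" "DERIV pseudo_cost z :> l"
      "pseudo_cost b - pseudo_cost a = (b - a) * l" by blast
    moreover have "l = d (\<phi> z)"
      using z that by (intro DERIV_unique[OF z(3) pseudo_cost_deriv]) auto
    ultimately show ?thesis by blast
  qed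
  show ?thesis
  proof (cases x y rule: linorder_cases)
    case less
    then obtain z where z: "x < z" "z < y" "pseudo_cost y - pseudo_cost x = (y - x) * d (\<phi> z)"
      using mvt assms by blast
    have "(y - x) * d (\<phi> z) \<le> (y - x) * d (\<phi> y)"
      using z assms by (intro mult_left_mono price_mono) auto
    with z show ?thesis by (simp add: mult.commute)
  next
    case greater
    then obtain z where z: "y < z" "z < x" "pseudo_cost x - pseudo_cost y = (x - y) * d (\<phi> z)"
      using mvt assms by blast
    have "(x - y) * d (\<phi> y) \<le> (x - y) * d (\<phi> z)"
      using z assms by (intro mult_left_mono price_mono) auto
    with z show ?thesis by (simp add: algebra_simps)
  qed simp
qed

lemma pseudo_utility_eq:
  assumes "\<And>j. 0 \<le> y $ j" "\<And>j. 0 < w $ j" "x \<in> allocations"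
  shows "pseudo_utility f \<phi> y (v, w) x = (\<Sum>j\<in>UNIV. v $ j * x $ j)
    - (\<Sum>j\<in>UNIV. pseudo_cost (y $ j + w $ j * x $ j) - pseudo_cost (y $ j))"
proof -
  have "integral {y $ j..y $ j + w $ j * x $ j} (\<lambda>\<eta>. d (\<phi> \<eta>))
      = pseudo_cost (y $ j + w $ j * x $ j) - pseudo_cost (y $ j)" for j
    using assms(1)[of j] assms(2)[of j] allocations_nonneg[OF assms(3), of j]
    by (intro integral_price) auto
  then show ?thesis by (simp add: pseudo_utility_def)
qed

lemma ex_arg_max_pseudo_utility:
  fixes y v w :: "real ^ 'm::finite"
  assumes "\<And>j. 0 \<le> y $ j" "\<And>j. 0 < w $ j"
  shows "\<exists>x. is_arg_max (pseudo_utility f \<phi> y (v, w)) (\<lambda>x. x \<in> allocations) x"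
proof -
  have "continuous_on allocations (\<lambda>x :: real ^ 'm. (\<Sum>j\<in>UNIV. v $ j * x $ j)
    - (\<Sum>j\<in>UNIV. pseudo_cost (y $ j + w $ j * x $ j) - pseudo_cost (y $ j)))"
    using assms
    by (intro continuous_intros continuous_on_compose2[OF continuous_on_pseudo_cost])
       (auto simp: less_imp_le allocations_nonneg)
  then have "continuous_on allocations (pseudo_utility f \<phi> y (v, w))"
    using assms by (subst continuous_on_cong[OF refl pseudo_utility_eq])
  then obtain x where "x \<in> allocations"
    "\<And>z. z \<in> allocations \<Longrightarrow> pseudo_utility f \<phi> y (v, w) z \<le> pseudo_utility f \<phi> y (v, w) x"
    using continuous_attains_sup[OF compact_allocations, of "pseudo_utility f \<phi> y (v, w)"]
      allocations_0 by blast
  then show ?thesis by (intro exI[of _ x]) (force simp: is_arg_max_def not_less)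
qed

text \<open>
  Maximality along the segment from \<open>x\<close> to \<open>z\<close>, divided by the step length: in the limit, \<open>x\<close>
  maximizes the utility linearized at the prices after its own allocation.
\<close>

lemma arg_max_first_order:
  fixes y v w :: "real ^ 'm::finite"
  assumes y: "\<And>j. 0 \<le> y $ j" and w: "\<And>j. 0 < w $ j"
    and x: "is_arg_max (pseudo_utility f \<phi> y (v, w)) (\<lambda>x. x \<in> allocations) x"
    and z: "z \<in> allocations"
  defines "p \<equiv> (\<lambda>j. d (\<phi> (y $ j + w $ j * x $ j)))"
  shows "(\<Sum>j\<in>UNIV. (v $ j - w $ j * p j) * z $ j) \<le> (\<Sum>j\<in>UNIV. (v $ j - w $ j * p j) * x $ j)"
proof -
  define c where "c s j = y $ j + w $ j * (x $ j + s * (z $ j - x $ j))" for s j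
  have xa: "x \<in> allocations" using x by (simp add: is_arg_max_def)
  have seg: "x + s *\<^sub>R (z - x) \<in> allocations" if "0 \<le> s" "s \<le> 1" for s
    using convexD_alt[OF convex_allocations xa z that] by (simp add: algebra_simps)
  have c_nonneg: "0 \<le> c s j" if "0 \<le> s" "s \<le> 1" for s j
    using y w[of j] allocations_nonneg[OF seg[OF that], of j] by (simp add: c_def less_imp_le)
  \<comment> \<open>Taking the tangent at the moved load \<open>c s\<close> lets the step length
    \<open>s\<close> cancel; what remains is continuous in \<open>s\<close>.\<close>
  have step: "(\<Sum>j\<in>UNIV. v $ j * (z $ j - x $ j))
      \<le> (\<Sum>j\<in>UNIV. d (\<phi> (c s j)) * (w $ j * (z $ j - x $ j)))"
    if s: "0 < s" "s \<le> 1" for s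
  proof -
    have "pseudo_utility f \<phi> y (v, w) (x + s *\<^sub>R (z - x)) \<le> pseudo_utility f \<phi> y (v, w) x"
      using x seg[of s] s by (force simp: is_arg_max_def not_less)
    then have "(\<Sum>j\<in>UNIV. v $ j * (x $ j + s * (z $ j - x $ j)))
        - (\<Sum>j\<in>UNIV. pseudo_cost (c s j) - pseudo_cost (y $ j))
      \<le> (\<Sum>j\<in>UNIV. v $ j * x $ j) - (\<Sum>j\<in>UNIV. pseudo_cost (c 0 j) - pseudo_cost (y $ j))"
      using pseudo_utility_eq[OF y w seg[of s]] pseudo_utility_eq[OF y w xa] s
      by (simp add: c_def)
    then have "s * (\<Sum>j\<in>UNIV. v $ j * (z $ j - x $ j))
        \<le> (\<Sum>j\<in>UNIV. pseudo_cost (c s j) - pseudo_cost (c 0 j))"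
      by (simp add: sum_subtractf sum.distrib algebra_simps sum_distrib_left)
    also have "\<dots> \<le> (\<Sum>j\<in>UNIV. d (\<phi> (c s j)) * (c s j - c 0 j))"
      using s by (intro sum_mono pseudo_cost_diff_le c_nonneg) auto
    also have "\<dots> = s * (\<Sum>j\<in>UNIV. d (\<phi> (c s j)) * (w $ j * (z $ j - x $ j)))"
      by (simp add: c_def sum_distrib_left algebra_simps)
    finally show ?thesis using s by simp
  qed
  have "continuous_on {0..1} (\<lambda>s. \<Sum>j\<in>UNIV. d (\<phi> (c s j)) * (w $ j * (z $ j - x $ j)))"
    by (intro continuous_intros continuous_on_compose2[OF continuous_on_price])
       (auto simp: c_nonneg, auto simp: c_def intro!: continuous_intros)
  then have "((\<lambda>s. \<Sum>j\<in>UNIV. d (\<phi> (c s j)) * (w $ j * (z $ j - x $ j))) \<longlongrightarrow>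
      (\<Sum>j\<in>UNIV. d (\<phi> (c 0 j)) * (w $ j * (z $ j - x $ j)))) (at 0 within {0..1})"
    by (auto simp: continuous_on_def)
  then have "((\<lambda>s. \<Sum>j\<in>UNIV. d (\<phi> (c s j)) * (w $ j * (z $ j - x $ j))) \<longlongrightarrow>
      (\<Sum>j\<in>UNIV. d (\<phi> (c 0 j)) * (w $ j * (z $ j - x $ j)))) (at_right 0)"
    by (simp add: at_within_Icc_at_right)
  moreover have "\<forall>\<^sub>F s in at_right 0. (\<Sum>j\<in>UNIV. v $ j * (z $ j - x $ j))
      \<le> (\<Sum>j\<in>UNIV. d (\<phi> (c s j)) * (w $ j * (z $ j - x $ j)))"
    using step by (auto simp: eventually_at_right_field intro!: exI[of _ 1])
  ultimately have "(\<Sum>j\<in>UNIV. v $ j * (z $ j - x $ j))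
      \<le> (\<Sum>j\<in>UNIV. d (\<phi> (c 0 j)) * (w $ j * (z $ j - x $ j)))"
    by (intro tendsto_lowerbound) auto
  then have "(\<Sum>j\<in>UNIV. (v $ j - w $ j * p j) * (z $ j - x $ j)) \<le> 0"
    by (simp add: c_def p_def algebra_simps sum_subtractf sum.distrib)
  then show ?thesis
    by (simp add: algebra_simps sum_subtractf sum.distrib)
qed

section \<open>Competitiveness of PUMax by weak duality\<close>

lemma is_PUMax_run_allocations:
  fixes A :: "'m::finite arrival list \<Rightarrow> real ^ 'm"
  assumes "is_PUMax f \<phi> A" "valid_instance I" "t < length I"
  shows "run A I t \<in> allocations"
  using assms by (auto simp: is_PUMax_def is_arg_max_def)

lemma is_PUMax_online_algorithm:
  fixes A :: "'m::finite arrival list \<Rightarrow> real ^ 'm"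
  assumes "is_PUMax f \<phi> A"
  shows "online_algorithm A"
  unfolding online_algorithm_def
proof (intro allI impI)
  fix I :: "'m arrival list" assume I: "valid_instance I" "I \<noteq> []"
  with is_PUMax_run_allocations[OF assms I(1), of "length I - 1"]
  show "A I \<in> allocations" by (simp add: run_def)
qed

text \<open>The Fenchel-Young inequality \<open>f z \<ge> d q * z - leg q\<close> at each node
  replaces the cost by linear prices \<open>d (q j)\<close>.\<close>

lemma objective_le_dual:
  assumes I: "valid_instance I" and x: "\<And>t. t < length I \<Longrightarrow> x t \<in> allocations"
    and q: "\<And>j. 0 \<le> q j"
  shows "objective f I x \<le>
    (\<Sum>t<length I. \<Sum>j\<in>UNIV. (fst (I ! t) $ j - snd (I ! t) $ j * d (q j)) * x t $ j)
    + (\<Sum>j\<in>UNIV. leg (q j))"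
proof -
  define z where "z j = (\<Sum>t<length I. snd (I ! t) $ j * x t $ j)" for j
  have "d (q j) * z j - leg (q j) \<le> f (z j)" for j
  proof -
    have "0 \<le> z j" unfolding z_def
      using I x by (intro sum_nonneg mult_nonneg_nonneg)
        (auto simp: valid_instanceD less_imp_le allocations_nonneg)
    from f_above_tangent[OF q[of j] this] show ?thesis
      by (simp add: leg_def algebra_simps)
  qed
  then have "(\<Sum>j\<in>UNIV. d (q j) * z j - leg (q j)) \<le> (\<Sum>j\<in>UNIV. f (z j))"
    by (rule sum_mono)
  moreover have "(\<Sum>j\<in>UNIV. d (q j) * z j)
      = (\<Sum>t<length I. \<Sum>j\<in>UNIV. snd (I ! t) $ j * d (q j) * x t $ j)"
    unfolding z_def sum_distrib_left by (subst sum.swap) (simp add: algebra_simps)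
  ultimately show ?thesis
    by (simp add: objective_def z_def[symmetric] sum_subtractf left_diff_distrib)
qed

text \<open>In the dual solution, nodes have the prices at the final loads, and demand
  \<open>t\<close> has the variable \<open>U t\<close>, its utility at the prices just after its own
  allocation.\<close>

lemma is_PUMax_competitive:
  fixes A :: "'m::finite arrival list \<Rightarrow> real ^ 'm"
  assumes A: "is_PUMax f \<phi> A"
  shows "competitive \<alpha> f A"
  unfolding competitive_def
proof (intro conjI allI impI)
  show "online_algorithm A" using A by (rule is_PUMax_online_algorithm)
  fix I :: "'m arrival list" assume I: "valid_instance I"
  define n where "n = length I"
  define v where "v t j = fst (I ! t) $ j" for t j
  define w where "w t j = snd (I ! t) $ j" for t j
  define y where "y t j = load A I t $ j" for t j
  define x where "x = run A I"
  define p where "p t j = d (\<phi> (y t j))" for t j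
  define U where "U t = (\<Sum>j\<in>UNIV. (v t j - w t j * p (Suc t) j) * x t $ j)" for t
  have xa: "x t \<in> allocations" if "t < n" for t
    using is_PUMax_run_allocations[OF A I] that by (simp add: x_def n_def)
  have w_pos: "0 < w t j" if "t < n" for t j
    using valid_instanceD[OF I] that by (simp add: w_def n_def)
  have y_0: "y 0 j = 0" for j by (simp add: y_def)
  have y_Suc: "y (Suc t) j = y t j + w t j * x t $ j" for t j
    by (simp add: y_def w_def x_def)
  have y_mono: "y s j \<le> y t j" if "s \<le> t" "t \<le> n" for s t j
    unfolding y_def using that is_PUMax_run_allocations[OF A I]
    by (intro load_mono[OF I]) (auto simp: n_def)
  have y_nonneg: "0 \<le> y t j" if "t \<le> n" for t j
    using y_mono[of 0 t j] y_0 that by simp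
  have first_order: "(\<Sum>j\<in>UNIV. (v t j - w t j * p (Suc t) j) * z $ j) \<le> U t"
    if "t < n" "z \<in> allocations" for t z
  proof -
    have "is_arg_max (pseudo_utility f \<phi> (load A I t) (fst (I ! t), snd (I ! t)))
        (\<lambda>x. x \<in> allocations) (x t)"
      using A I that by (simp add: is_PUMax_def n_def x_def)
    from arg_max_first_order[OF _ _ this that(2)] show ?thesis
      using y_nonneg[of t] w_pos[of t] that
      by (simp add: U_def p_def y_Suc) (simp add: y_def v_def w_def)
  qed
  have U_nonneg: "0 \<le> U t" if "t < n" for t
    using first_order[OF that allocations_0] by simp
  \<comment> \<open>Load bought at the price after each step pays for at least the pseudo-cost of
    the final load.\<close>
  have telescope: "pseudo_cost (y n j) \<le> (\<Sum>t<n. w t j * x t $ j * p (Suc t) j)" for j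
  proof -
    have "pseudo_cost (y n j) = (\<Sum>t<n. pseudo_cost (y (Suc t) j) - pseudo_cost (y t j))"
      by (subst sum_lessThan_telescope) (simp add: y_0 pseudo_cost_0)
    also have "\<dots> \<le> (\<Sum>t<n. d (\<phi> (y (Suc t) j)) * (y (Suc t) j - y t j))"
      by (intro sum_mono pseudo_cost_diff_le y_nonneg) auto
    also have "\<dots> = (\<Sum>t<n. w t j * x t $ j * p (Suc t) j)"
      by (simp add: p_def y_Suc mult.commute)
    finally show ?thesis .
  qed
  \<comment> \<open>Since \<open>pseudo_cost y - f y = leg (\<phi> y) / \<alpha>\<close>, the factor
    \<open>\<alpha>\<close> restores \<open>leg\<close> exactly; on the nonnegative utilities it
    only helps, as \<open>\<alpha> \<ge> 1\<close>.\<close>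
  have dual_le: "(\<Sum>t<n. U t) + (\<Sum>j\<in>UNIV. leg (\<phi> (y n j))) \<le> \<alpha> * ALG f A I"
  proof -
    have "ALG f A I = (\<Sum>t<n. \<Sum>j\<in>UNIV. v t j * x t $ j) - (\<Sum>j\<in>UNIV. f (y n j))"
      by (simp add: ALG_def objective_def n_def v_def x_def y_def load_eq_sum)
    also have "(\<Sum>t<n. \<Sum>j\<in>UNIV. v t j * x t $ j)
        = (\<Sum>t<n. U t) + (\<Sum>j\<in>UNIV. \<Sum>t<n. w t j * x t $ j * p (Suc t) j)"
      by (subst (2) sum.swap) (simp add: U_def flip: sum.distrib, simp add: algebra_simps)
    finally have "(\<Sum>t<n. U t) + (\<Sum>j\<in>UNIV. pseudo_cost (y n j) - f (y n j)) \<le> ALG f A I"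
      using sum_mono[of UNIV "\<lambda>j. pseudo_cost (y n j)", OF telescope] by (simp add: sum_subtractf)
    then have "\<alpha> * ((\<Sum>t<n. U t) + (\<Sum>j\<in>UNIV. leg (\<phi> (y n j))) / \<alpha>) \<le> \<alpha> * ALG f A I"
      using \<alpha>_ge_1 by (simp add: pseudo_cost_def sum_divide_distrib)
    moreover have "(\<Sum>t<n. U t) \<le> \<alpha> * (\<Sum>t<n. U t)"
      using \<alpha>_ge_1 sum_nonneg[of "{..<n}" U] U_nonneg mult_right_mono[of 1 \<alpha> "\<Sum>t<n. U t"]
      by simp
    ultimately show ?thesis using \<alpha>_ge_1 by (simp add: distrib_left)
  qed
  show "OPT f I \<le> \<alpha> * ALG f A I"
    unfolding OPT_def
  proof (rule cSUP_least)
    show "{x. \<forall>t<length I. x t \<in> allocations} \<noteq> ({} :: (nat \<Rightarrow> real ^ 'm) set)"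
      by (auto intro: exI[of _ "\<lambda>_. 0"])
    fix z assume "z \<in> {x :: nat \<Rightarrow> real ^ 'm. \<forall>t<length I. x t \<in> allocations}"
    then have z: "z t \<in> allocations" if "t < n" for t using that by (simp add: n_def)
    have "objective f I z \<le> (\<Sum>t<n. \<Sum>j\<in>UNIV. (v t j - w t j * p n j) * z t $ j)
        + (\<Sum>j\<in>UNIV. leg (\<phi> (y n j)))"
      using objective_le_dual[OF I, of z "\<lambda>j. \<phi> (y n j)"] z y_nonneg \<phi>_nonneg
      by (simp add: n_def v_def w_def p_def)
    also have "(\<Sum>t<n. \<Sum>j\<in>UNIV. (v t j - w t j * p n j) * z t $ j)
        \<le> (\<Sum>t<n. \<Sum>j\<in>UNIV. (v t j - w t j * p (Suc t) j) * z t $ j)"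
    \<comment> \<open>Loads only grow, so the final prices are at least those after step
      \<open>t\<close>.\<close>
    proof (intro sum_mono mult_right_mono diff_left_mono mult_left_mono)
      fix t j assume "t \<in> {..<n}"
      then show "p (Suc t) j \<le> p n j" "0 \<le> w t j" "0 \<le> z t $ j"
        using y_nonneg y_mono z[of t] w_pos[of t j]
        by (auto simp: p_def allocations_nonneg less_imp_le intro!: price_mono)
    qed
    also have "\<dots> \<le> (\<Sum>t<n. U t)"
      by (intro sum_mono first_order z) auto
    finally show "objective f I z \<le> \<alpha> * ALG f A I" using dual_le by simp
  qed
qed

text \<open>An algorithm sees only the history, so it recomputes the loads by folding
  \<open>upd\<close> over all arrivals but the last. \<open>SOME\<close> breaks ties.\<close>

lemma ex_is_PUMax: "\<exists>A :: 'm::finite arrival list \<Rightarrow> real ^ 'm. is_PUMax f \<phi> A"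
proof -
  define choice where "choice y a =
    (SOME x. is_arg_max (pseudo_utility f \<phi> y a) (\<lambda>x. x \<in> allocations) x)"
    for y :: "real ^ 'm" and a
  define upd where "upd y a = (\<chi> j. y $ j + snd a $ j * choice y a $ j)" for y a
  define A where "A I = choice (foldl upd 0 (butlast I)) (last I)" for I
  have run_A: "run A I t = choice (foldl upd 0 (take t I)) (I ! t)" if "t < length I" for I t
    using that by (simp add: run_def A_def take_Suc_conv_app_nth)
  have load_A: "load A I t = foldl upd 0 (take t I)" if "t \<le> length I" for I t
    using that by (induction t) (simp_all add: take_Suc_conv_app_nth run_A upd_def)
  have arg_max: "is_arg_max (pseudo_utility f \<phi> y a) (\<lambda>x. x \<in> allocations) (choice y a)"
    if "\<And>j. 0 \<le> y $ j" "\<And>j. 0 < snd a $ j" for y a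
    unfolding choice_def
    using ex_arg_max_pseudo_utility[of y "snd a" "fst a"] that by (auto intro: someI_ex)
  have "is_PUMax f \<phi> A"
    unfolding is_PUMax_def
  proof (intro allI impI)
    fix I :: "'m arrival list" and t assume I: "valid_instance I" and t: "t < length I"
    \<comment> \<open>Maximizers are known to exist at nonnegative loads, and feasible choices keep
      the loads nonnegative; hence the induction.\<close>
    have nonneg: "0 \<le> load A I s $ j" if "s \<le> length I" for s j
      using that
    proof (induction s arbitrary: j)
      case (Suc s)
      then have "choice (load A I s) (I ! s) \<in> allocations"
        using arg_max[of "load A I s" "I ! s"] valid_instanceD[OF I] by (auto simp: is_arg_max_def)
      with Suc show ?case
        using valid_instanceD[OF I, of s j]
        by (simp add: run_A load_A[symmetric] allocations_nonneg less_imp_le)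
    qed simp
    show "is_arg_max (pseudo_utility f \<phi> (load A I t) (I ! t)) (\<lambda>x. x \<in> allocations) (run A I t)"
      using arg_max[of "load A I t" "I ! t"] nonneg[of t] valid_instanceD[OF I t] t
      by (simp add: run_A load_A)
  qed
  then show ?thesis by blast
qed

end

subsection \<open>Scalar differential equations\<close>

text \<open>A comparison principle for differences of two curves, whose derivative has a known sign
  only where one exceeds the other. If \<open>h b < h a\<close>, take the first time at which
  \<open>h\<close> is at most some positive level \<open>c < h a\<close>; until then
  \<open>h\<close> is positive, hence nondecreasing.\<close>

lemma positive_imp_nondecreasing:
  fixes h :: "real \<Rightarrow> real"
  assumes "a \<le> b" and cont: "continuous_on {a..b} h" and "0 < h a"
    and deriv: "\<And>t. a < t \<Longrightarrow> t < b \<Longrightarrow> 0 < h t \<Longrightarrow> \<exists>l\<ge>0. (h has_real_derivative l) (at t)"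
  shows "h a \<le> h b"
proof (rule ccontr)
  assume "\<not> h a \<le> h b"
  \<comment> \<open>The term \<open>h a / 2\<close> keeps the level positive even if
    \<open>h b \<le> 0\<close>.\<close>
  define c where "c = max (h b) (h a / 2)"
  have c: "0 < c" "c < h a" "h b \<le> c"
    using \<open>\<not> h a \<le> h b\<close> \<open>0 < h a\<close> by (auto simp: c_def)
  define S where "S = {t \<in> {a..b}. h t \<le> c}"
  have "closed S"
    unfolding S_def by (intro continuous_on_closed_Collect_le cont continuous_on_const) auto
  then have "compact S"
    by (auto simp: compact_eq_bounded_closed S_def intro: bounded_subset[of "{a..b}"])
  moreover have "b \<in> S" using c \<open>a \<le> b\<close> by (simp add: S_def)
  ultimately obtain s where s: "s \<in> S" "\<And>t. t \<in> S \<Longrightarrow> s \<le> t"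
    using compact_attains_inf[of S] by blast
  have "h a \<le> h s"
  proof (rule DERIV_nonneg_imp_increasing_open[of a s h])
    show "a \<le> s" using s by (simp add: S_def)
    show "continuous_on {a..s} h" using s by (intro continuous_on_subset[OF cont]) (auto simp: S_def)
    fix t assume t: "a < t" "t < s"
    then have "c < h t" using s(2)[of t] s(1) by (force simp: S_def)
    then show "\<exists>l. (h has_real_derivative l) (at t) \<and> 0 \<le> l"
      using deriv[of t] t s(1) c by (auto simp: S_def)
  qed
  with s c show False by (simp add: S_def)
qed

lemma picard_lindelof_scalar:
  fixes F :: "real \<Rightarrow> real \<Rightarrow> real"
  assumes T: "0 \<le> T" and c: "0 < c"
    and cont: "\<And>u. continuous_on {0..T} u \<Longrightarrow> continuous_on {0..T} (\<lambda>t. F t (u t))"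
    and lip: "\<And>t x y. t \<in> {0..T} \<Longrightarrow> \<bar>F t x - F t y\<bar> \<le> c * \<bar>x - y\<bar>"
  obtains u where "u 0 = x0"
    and "\<And>t. t \<in> {0..T} \<Longrightarrow> (u has_real_derivative F t (u t)) (at t within {0..T})"
proof -
  text \<open>The integral operator, conjugated by \<open>exp (2 * c * t)\<close>, halves the supremum distance.\<close>
  define cl where "cl t = max 0 (min T t)" for t
  define G where "G v t = F t (exp (2 * c * t) * apply_bcontfun v t)" for v t
  define P where "P v t = exp (- (2 * c * t)) * (x0 + integral {0..t} (G v))" for v t
  have cl: "cl t \<in> {0..T}" "t \<in> {0..T} \<Longrightarrow> cl t = t" for t using T by (auto simp: cl_def)
  have G_cont: "continuous_on {0..T} (G v)" for v
    unfolding G_def by (intro cont continuous_intros) auto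
  have P_cont: "continuous_on {0..T} (P v)" for v
    unfolding P_def
    by (intro continuous_intros indefinite_integral_continuous_1 integrable_continuous_interval G_cont)
  have P_bcont: "(\<lambda>t. P v (cl t)) \<in> bcontfun" for v
  proof -
    have "continuous_on UNIV (\<lambda>t. P v (cl t))"
      by (rule continuous_on_compose2[OF P_cont])
         (use cl in \<open>auto simp: cl_def intro!: continuous_intros\<close>)
    moreover have "range (\<lambda>t. P v (cl t)) \<subseteq> P v ` {0..T}" using cl by blast
    then have "bounded (range (\<lambda>t. P v (cl t)))"
      using bounded_subset compact_imp_bounded[OF compact_continuous_image[OF P_cont]] by blast
    ultimately show ?thesis by (simp add: bcontfun_def)
  qed
  define Q where "Q v = Bcontfun (\<lambda>t. P v (cl t))" for v
  have Q: "apply_bcontfun (Q v) t = P v (cl t)" for v t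
    by (simp add: Q_def Bcontfun_inverse P_bcont)
  have "\<exists>!v. Q v = v"
  proof (rule banach_fix_type)
    show "\<forall>v w. dist (Q v) (Q w) \<le> (1 / 2) * dist v w"
    proof (intro allI dist_bound)
      fix v w :: "real \<Rightarrow>\<^sub>C real" and t
      define s where "s = cl t"
      have s: "s \<in> {0..T}" using cl by (simp add: s_def)
      have int: "G v integrable_on {0..s}" for v
        using s by (intro integrable_continuous_interval continuous_on_subset[OF G_cont]) auto
      \<comment> \<open>Integrating the weight \<open>c * exp (2 * c * r)\<close> is what produces
        the contraction factor \<open>1 / 2\<close>.\<close>
      have g: "((\<lambda>r. c * exp (2 * c * r) * dist v w) has_integral
          exp (2 * c * s) * dist v w / 2 - exp (2 * c * 0) * dist v w / 2) {0..s}"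
        using s c
        by (intro fundamental_theorem_of_calculus)
           (auto simp flip: has_real_derivative_iff_has_vector_derivative
             intro!: derivative_eq_intros)
      have "norm (integral {0..s} (\<lambda>r. G v r - G w r))
          \<le> integral {0..s} (\<lambda>r. c * exp (2 * c * r) * dist v w)"
      proof (rule integral_norm_bound_integral)
        show "(\<lambda>r. G v r - G w r) integrable_on {0..s}" by (intro integrable_diff int)
        show "(\<lambda>r. c * exp (2 * c * r) * dist v w) integrable_on {0..s}" using g by blast
        fix r assume r: "r \<in> {0..s}"
        have "\<bar>G v r - G w r\<bar> \<le>
            c * \<bar>exp (2 * c * r) * apply_bcontfun v r - exp (2 * c * r) * apply_bcontfun w r\<bar>"
          unfolding G_def using r s by (intro lip) auto
        also have "\<dots> = c * exp (2 * c * r) * dist (apply_bcontfun v r) (apply_bcontfun w r)"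
          by (simp add: dist_real_def abs_mult flip: right_diff_distrib)
        also have "\<dots> \<le> c * exp (2 * c * r) * dist v w"
          using c by (intro mult_left_mono dist_bounded) auto
        finally show "norm (G v r - G w r) \<le> c * exp (2 * c * r) * dist v w" by simp
      qed
      also have "\<dots> \<le> exp (2 * c * s) * dist v w / 2"
        using integral_unique[OF g] by simp
      finally have "\<bar>integral {0..s} (G v) - integral {0..s} (G w)\<bar> \<le> exp (2 * c * s) * dist v w / 2"
        by (simp add: integral_diff int)
      then have "exp (- (2 * c * s)) * \<bar>integral {0..s} (G v) - integral {0..s} (G w)\<bar>
          \<le> exp (- (2 * c * s)) * (exp (2 * c * s) * dist v w / 2)"
        by (intro mult_left_mono) auto
      also have "\<dots> = 1 / 2 * dist v w"
        by (simp add: exp_minus field_simps)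
      finally show "dist (apply_bcontfun (Q v) t) (apply_bcontfun (Q w) t) \<le> 1 / 2 * dist v w"
        by (simp add: Q P_def s_def[symmetric] dist_real_def abs_mult flip: right_diff_distrib)
    qed
  qed auto
  then obtain v where v: "Q v = v" by blast
  define u where "u t = exp (2 * c * t) * apply_bcontfun v t" for t
  have u: "u t = x0 + integral {0..t} (\<lambda>s. F s (u s))" if "t \<in> {0..T}" for t
  proof -
    have "apply_bcontfun v t = exp (- (2 * c * t)) * (x0 + integral {0..t} (\<lambda>s. F s (u s)))"
      using Q[of v t] cl(2)[OF that] unfolding v by (simp add: P_def G_def[abs_def] u_def)
    then show ?thesis by (simp add: u_def exp_minus field_simps)
  qed
  have u_cont: "continuous_on {0..T} u"
    unfolding u_def by (intro continuous_intros) auto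
  show thesis
  proof (rule that)
    show "u 0 = x0" using u[of 0] T by simp
    fix t assume t: "t \<in> {0..T}"
    have "((\<lambda>t. x0 + integral {0..t} (\<lambda>s. F s (u s))) has_real_derivative 0 + F t (u t))
        (at t within {0..T})"
      by (intro DERIV_add DERIV_const integral_has_real_derivative cont u_cont t)
    then show "(u has_real_derivative F t (u t)) (at t within {0..T})"
      using u t by (subst has_field_derivative_cong_eventually[where g = "\<lambda>t. x0 + integral {0..t} (\<lambda>s. F s (u s))"])
        (auto simp: eventually_at_filter)
  qed
qed

text \<open>Replacing \<open>t\<close> by \<open>T - t\<close> turns the terminal condition into an
  initial one and negates the right-hand side.\<close>

lemma picard_lindelof_scalar_backward:
  fixes F :: "real \<Rightarrow> real \<Rightarrow> real"
  assumes T: "0 \<le> T" and c: "0 < c"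
    and cont: "\<And>u. continuous_on {0..T} u \<Longrightarrow> continuous_on {0..T} (\<lambda>t. F t (u t))"
    and lip: "\<And>t x y. t \<in> {0..T} \<Longrightarrow> \<bar>F t x - F t y\<bar> \<le> c * \<bar>x - y\<bar>"
  obtains u where "u T = x1"
    and "\<And>t. t \<in> {0..T} \<Longrightarrow> (u has_real_derivative F t (u t)) (at t within {0..T})"
proof -
  have image: "(\<lambda>t. T - t) ` {0..T} = {0..T}" by (force simp: image_iff intro: bexI[of _ "T - _"])
  obtain v where v: "v 0 = x1"
    "\<And>t. t \<in> {0..T} \<Longrightarrow> (v has_real_derivative - F (T - t) (v t)) (at t within {0..T})"
  proof (rule picard_lindelof_scalar[of T c "\<lambda>t x. - F (T - t) x" x1])
    fix u :: "real \<Rightarrow> real" assume u: "continuous_on {0..T} u"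
    have *: "continuous_on {0..T} (\<lambda>t. F t (u (T - t)))"
      by (intro cont continuous_on_compose2[OF u] continuous_intros) auto
    have "continuous_on {0..T} (\<lambda>t. F (T - t) (u (T - (T - t))))"
      by (rule continuous_on_compose2[OF *, of _ "\<lambda>t. T - t"]) (auto intro!: continuous_intros)
    then show "continuous_on {0..T} (\<lambda>t. - F (T - t) (u t))"
      by (intro continuous_intros) simp
  next
    fix t x y assume "t \<in> {0..T}"
    then show "\<bar>- F (T - t) x - - F (T - t) y\<bar> \<le> c * \<bar>x - y\<bar>"
      using lip[of "T - t" x y] by (simp add: abs_minus_commute)
  qed (use T c in auto)
  show thesis
  proof (rule that[of "\<lambda>t. v (T - t)"])
    show "v (T - T) = x1" using v by simp
    fix t assume t: "t \<in> {0..T}"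
    have "(v has_real_derivative - F (T - (T - t)) (v (T - t))) (at (T - t) within (\<lambda>t. T - t) ` {0..T})"
      unfolding image using t by (intro v) auto
    moreover have "((\<lambda>t. T - t) has_real_derivative - 1) (at t within {0..T})"
      by (auto intro!: derivative_eq_intros)
    ultimately have "((v \<circ> (\<lambda>t. T - t)) has_real_derivative - F (T - (T - t)) (v (T - t)) * - 1)
        (at t within {0..T})"
      by (rule DERIV_image_chain)
    then show "((\<lambda>t. v (T - t)) has_real_derivative F t (v (T - t))) (at t within {0..T})"
      by (simp add: o_def)
  qed
qed

subsection \<open>Backward solutions of the reserve equation\<close>

context convex_cost
begin

lemma leg_intermediate:
  assumes "0 \<le> a" "a \<le> b" "leg a \<le> y" "y \<le> leg b"
  obtains q where "a \<le> q" "q \<le> b" "leg q = y"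
proof -
  have "continuous_on {a..b} leg"
    using assms by (intro continuous_on_subset[OF continuous_on_leg]) auto
  with IVT'[of leg a y b] assms that show thesis by blast
qed

text \<open>Clamping the inverse of \<open>leg\<close> to \<open>[1/n, n]\<close> makes \<open>\<lambda>u. d (leg\<^sup>-\<^sup>1 u)\<close> globally Lipschitz.\<close>

definition clamped_inv :: "real \<Rightarrow> real \<Rightarrow> real" where
  "clamped_inv n u = inv_into {1 / n..n} leg (max (leg (1 / n)) (min u (leg n)))"

text \<open>\<open>U\<close> stands for \<open>leg \<circ> \<phi>\<close>. On
  \<open>[1 / n, n]\<close> the clamp is inactive by \<open>leg_clamped_inv_U\<close>; nearer to 0
  the equation may differ from the reserve equation.\<close>

definition backward_solution :: "real \<Rightarrow> real \<Rightarrow> (real \<Rightarrow> real) \<Rightarrow> bool" where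
  "backward_solution \<alpha> n U \<longleftrightarrow> U n = leg n \<and>
     (\<forall>t\<in>{0..n}. (U has_real_derivative \<alpha> * (d (clamped_inv n (U t)) - d t)) (at t within {0..n}))"

lemma
  assumes "1 \<le> n"
  shows clamped_inv_ge: "1 / n \<le> clamped_inv n u"
    and leg_clamped_inv: "leg (clamped_inv n u) = max (leg (1 / n)) (min u (leg n))"
proof -
  have n: "0 \<le> 1 / n" "1 / n \<le> n"
    using assms mult_mono[of 1 n 1 n] by (auto simp: field_simps)
  then obtain q where "1 / n \<le> q" "q \<le> n" "leg q = max (leg (1 / n)) (min u (leg n))"
    using leg_mono[OF n] by (auto intro: leg_intermediate[OF n, of "max (leg (1 / n)) (min u (leg n))"])
  then have *: "max (leg (1 / n)) (min u (leg n)) \<in> leg ` {1 / n..n}" by (metis atLeastAtMost_iff imageI)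
  from inv_into_into[OF *] f_inv_into_f[OF *] show "1 / n \<le> clamped_inv n u"
    "leg (clamped_inv n u) = max (leg (1 / n)) (min u (leg n))"
    by (auto simp: clamped_inv_def)
qed

lemma clamped_inv_nonneg: "1 \<le> n \<Longrightarrow> 0 \<le> clamped_inv n u"
  using clamped_inv_ge[of n u] by (meson divide_nonneg_nonneg order_trans zero_le_one)

lemma le_clamped_inv:
  assumes "1 \<le> n" "0 \<le> q" "q \<le> n" "leg q \<le> u"
  shows "q \<le> clamped_inv n u"
  using assms leg_clamped_inv[of n u] leg_mono[of q n]
  by (subst leg_le_iff[symmetric]) (auto simp: clamped_inv_nonneg)

lemma leg_clamped_inv_eq:
  assumes "1 \<le> n" "1 / n \<le> y" "leg y \<le> u" "u \<le> leg n"
  shows "leg (clamped_inv n u) = u"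
proof -
  have "leg (1 / n) \<le> leg y" using assms by (intro leg_mono) auto
  with assms show ?thesis by (simp add: leg_clamped_inv)
qed

text \<open>Above 1, \<open>leg_growth\<close> bounds the rise of \<open>d\<close> by that of
  \<open>leg\<close>. The bound is linear in \<open>u\<close> and free of \<open>n\<close>, as the
  Gronwall estimate requires.\<close>

lemma price_clamped_inv_le:
  assumes "1 \<le> n" "0 \<le> u"
  shows "d (clamped_inv n u) \<le> d 1 + u"
proof (cases "clamped_inv n u \<le> 1")
  case True
  then show ?thesis using d_mono[OF clamped_inv_nonneg True] assms by simp
next
  case False
  have "leg (1 / n) \<le> leg 1" "leg 1 < leg (clamped_inv n u)"
    using assms False by (auto intro: leg_mono leg_strict_mono)
  then have "leg (clamped_inv n u) \<le> u"
    using leg_clamped_inv[of n u] assms by (auto simp: max_def split: if_splits)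
  then show ?thesis
    using leg_growth[of 1 "clamped_inv n u"] leg_nonneg[of 1] False by simp
qed

lemma clamped_price_lipschitz:
  assumes "1 \<le> n"
  shows "\<bar>d (clamped_inv n u) - d (clamped_inv n v)\<bar> \<le> n * \<bar>u - v\<bar>"
proof -
  have "1 / n * \<bar>d (clamped_inv n u) - d (clamped_inv n v)\<bar>
      \<le> \<bar>leg (clamped_inv n u) - leg (clamped_inv n v)\<bar>"
    using assms by (intro d_lipschitz clamped_inv_ge) auto
  also have "\<dots> \<le> \<bar>u - v\<bar>"
    using assms by (simp add: leg_clamped_inv)
  finally show ?thesis using assms by (simp add: field_simps)
qed

lemma ex_backward_solution:
  assumes "1 \<le> n" "0 < \<alpha>"
  shows "\<exists>U. backward_solution \<alpha> n U"
proof -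
  have lip: "\<bar>\<alpha> * (d (clamped_inv n x) - d t) - \<alpha> * (d (clamped_inv n y) - d t)\<bar>
      \<le> (\<alpha> * n) * \<bar>x - y\<bar>" for t x y
  proof -
    have "\<alpha> * \<bar>d (clamped_inv n x) - d (clamped_inv n y)\<bar> \<le> \<alpha> * (n * \<bar>x - y\<bar>)"
      using assms by (intro mult_left_mono clamped_price_lipschitz) auto
    moreover have "\<bar>\<alpha> * (d (clamped_inv n x) - d t) - \<alpha> * (d (clamped_inv n y) - d t)\<bar>
      = \<alpha> * \<bar>d (clamped_inv n x) - d (clamped_inv n y)\<bar>"
      using assms by (simp add: abs_mult flip: right_diff_distrib)
    ultimately show ?thesis by simp
  qed
  have "continuous_on UNIV (\<lambda>u. d (clamped_inv n u))"
    using clamped_price_lipschitz[OF assms(1)] assms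
    by (intro lipschitz_on_continuous_on[of n] lipschitz_onI) (auto simp: dist_real_def)
  then have cont: "continuous_on {0..n} (\<lambda>t. \<alpha> * (d (clamped_inv n (u t)) - d t))"
    if "continuous_on {0..n} u" for u
    using that
    by (intro continuous_intros continuous_on_compose2[of UNIV "\<lambda>u. d (clamped_inv n u)" _ u]
        continuous_on_subset[OF continuous_on_d]) auto
  obtain U where "U n = leg n" "\<And>t. t \<in> {0..n} \<Longrightarrow>
      (U has_real_derivative \<alpha> * (d (clamped_inv n (U t)) - d t)) (at t within {0..n})"
    by (rule picard_lindelof_scalar_backward[OF _ _ cont lip, of "leg n"]) (use assms in auto)
  then show ?thesis by (auto simp: backward_solution_def)
qed

end

locale backward = convex_cost +
  fixes \<alpha> n :: real and U :: "real \<Rightarrow> real"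
  assumes \<alpha>: "1 \<le> \<alpha>" and n: "1 \<le> n" and U: "backward_solution \<alpha> n U"
begin

lemma U_n: "U n = leg n"
  using U by (simp add: backward_solution_def)

lemma U_deriv_within: "0 \<le> t \<Longrightarrow> t \<le> n \<Longrightarrow>
    (U has_real_derivative \<alpha> * (d (clamped_inv n (U t)) - d t)) (at t within {0..n})"
  using U by (simp add: backward_solution_def)

lemma U_deriv: "0 < t \<Longrightarrow> t < n \<Longrightarrow>
    (U has_real_derivative \<alpha> * (d (clamped_inv n (U t)) - d t)) (at t)"
  using U_deriv_within[of t] at_within_interior[of t "{0..n}"] by simp

lemma continuous_on_U: "continuous_on {0..n} U"
  using DERIV_continuous[OF U_deriv_within] by (simp add: continuous_on_eq_continuous_within)

lemma inverse_n: "0 < 1 / n" "1 / n \<le> n"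
  using n mult_mono[of 1 n 1 n] by (auto simp: field_simps)

lemma inverse_n_le_imp_pos: "1 / n \<le> y \<Longrightarrow> 0 < y"
  using inverse_n(1) by (rule order.strict_trans2)

text \<open>Where \<open>leg\<close> exceeds \<open>U\<close>, the clamped inverse of
  \<open>U t\<close> is at most \<open>t\<close>, so \<open>U\<close> does not increase while
  \<open>leg\<close> does. The gap would persist up to \<open>n\<close>, where the two agree. For
  \<open>t \<ge> 1 / n\<close> the lower clamp does no harm.\<close>

lemma leg_le_U:
  assumes "1 / n \<le> y" "y \<le> n"
  shows "leg y \<le> U y"
proof (rule ccontr)
  assume less: "\<not> leg y \<le> U y"
  have y: "0 < y" using assms(1) by (rule inverse_n_le_imp_pos)
  have "leg y - U y \<le> leg n - U n"
  proof (rule positive_imp_nondecreasing[of y n "\<lambda>y. leg y - U y"])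
    show "continuous_on {y..n} (\<lambda>y. leg y - U y)"
      using assms y
      by (intro continuous_intros continuous_on_subset[OF continuous_on_leg]
          continuous_on_subset[OF continuous_on_U]) auto
    fix t assume t: "y < t" "t < n" "0 < leg t - U t"
    have "clamped_inv n (U t) \<le> t"
    proof -
      have "leg (clamped_inv n (U t)) \<le> leg t"
        using t assms n inverse_n leg_mono[of "1 / n" t] by (auto simp: leg_clamped_inv)
      then show ?thesis using t y n by (simp add: leg_le_iff clamped_inv_nonneg)
    qed
    then have "\<alpha> * (d (clamped_inv n (U t)) - d t) \<le> 0"
      using d_mono[of "clamped_inv n (U t)" t] \<alpha> n by (simp add: mult_le_0_iff clamped_inv_nonneg)
    moreover have "0 \<le> t * d2 t" using t y d2_pos[of t] by simp
    ultimately show "\<exists>l\<ge>0. ((\<lambda>y. leg y - U y) has_real_derivative l) (at t)"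
      using t y by (intro exI[of _ "t * d2 t - \<alpha> * (d (clamped_inv n (U t)) - d t)"] conjI
          DERIV_diff leg_deriv U_deriv) auto
  qed (use assms less in auto)
  with less U_n show False by simp
qed

text \<open>From \<open>1 / n\<close> on this is \<open>leg_le_U\<close>; below, the lower clamp
  itself gives it. Hence \<open>U\<close> is nondecreasing on all of \<open>[0, n]\<close>.\<close>

lemma le_clamped_inv_U:
  assumes "0 \<le> t" "t \<le> n"
  shows "t \<le> clamped_inv n (U t)"
proof (cases "1 / n \<le> t")
  case True
  then show ?thesis using assms n leg_le_U by (intro le_clamped_inv) auto
next
  case False
  then show ?thesis using clamped_inv_ge[OF n, of "U t"] by simp
qed

lemma U_mono:
  assumes "0 \<le> x" "x \<le> y" "y \<le> n"
  shows "U x \<le> U y"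
proof (rule DERIV_nonneg_imp_increasing_open[of x y U])
  fix t assume t: "x < t" "t < y"
  then have "d t \<le> d (clamped_inv n (U t))"
    using assms by (intro d_mono le_clamped_inv_U) auto
  then have "0 \<le> \<alpha> * (d (clamped_inv n (U t)) - d t)" using \<alpha> by simp
  then show "\<exists>l. (U has_real_derivative l) (at t) \<and> 0 \<le> l"
    using U_deriv[of t] t assms by auto
qed (use assms continuous_on_subset[OF continuous_on_U, of "{x..y}"] in auto)

lemma U_le: "0 \<le> t \<Longrightarrow> t \<le> n \<Longrightarrow> U t \<le> leg n"
  using U_mono[of t n] U_n by simp

lemma leg_clamped_inv_U:
  assumes "1 / n \<le> t" "t \<le> n"
  shows "leg (clamped_inv n (U t)) = U t"
  using assms n leg_le_U U_le inverse_n_le_imp_pos[of t]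
  by (intro leg_clamped_inv_eq[of n t]) auto

text \<open>Where \<open>U\<close> exceeds \<open>U'\<close> it also grows at least as fast, so an
  excess would persist up to \<open>n\<close>; but there
  \<open>U n = leg n \<le> U' n\<close>.\<close>

lemma U_le_of_larger:
  assumes U': "backward f \<alpha> n' U'" and "n \<le> n'" and y: "1 / n \<le> y" "y \<le> n"
  shows "U y \<le> U' y"
proof (rule ccontr)
  interpret B: backward f \<alpha> n' U' by (rule U')
  assume less: "\<not> U y \<le> U' y"
  have "1 / n' \<le> 1 / n" using n assms by (intro divide_left_mono) auto
  then have in_range: "1 / n' \<le> t" "t \<le> n'" if "1 / n \<le> t" "t \<le> n" for t
    using that assms by auto
  have "U y - U' y \<le> U n - U' n"
  proof (rule positive_imp_nondecreasing[of _ _ "\<lambda>y. U y - U' y"])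
    show "continuous_on {y..n} (\<lambda>y. U y - U' y)"
      using assms inverse_n_le_imp_pos[OF y(1)]
      by (intro continuous_intros continuous_on_subset[OF continuous_on_U]
          continuous_on_subset[OF B.continuous_on_U]) auto
    fix t assume t: "y < t" "t < n" "0 < U t - U' t"
    then have t': "1 / n \<le> t" "0 < t" "t < n'" using y inverse_n_le_imp_pos[OF y(1)] \<open>n \<le> n'\<close> by auto
    have "leg (clamped_inv n' (U' t)) \<le> leg (clamped_inv n (U t))"
      using t t' in_range[of t] by (simp add: leg_clamped_inv_U B.leg_clamped_inv_U)
    then have "d (clamped_inv n' (U' t)) \<le> d (clamped_inv n (U t))"
      using n B.n by (intro d_mono) (auto simp: leg_le_iff clamped_inv_nonneg)
    then have "0 \<le> \<alpha> * (d (clamped_inv n (U t)) - d t) - \<alpha> * (d (clamped_inv n' (U' t)) - d t)"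
      using \<alpha> by (simp flip: right_diff_distrib)
    then show "\<exists>l\<ge>0. ((\<lambda>y. U y - U' y) has_real_derivative l) (at t)"
      using t t' by (blast intro: DERIV_diff U_deriv B.U_deriv)
  qed (use y less in auto)
  moreover have "U n \<le> U' n"
    using B.leg_le_U[of n] in_range[of n] inverse_n U_n by simp
  ultimately show False using less by simp
qed

text \<open>A Gronwall estimate: while positive, \<open>U\<close> grows no faster than \<open>z' = \<alpha> * (d 1 + z)\<close>.\<close>

lemma U_le_exp:
  assumes "U 0 \<le> 0" "0 \<le> b" "b \<le> n"
  shows "U b \<le> d 1 * (exp (\<alpha> * b) - 1)"
proof (rule ccontr)
  assume less: "\<not> U b \<le> d 1 * (exp (\<alpha> * b) - 1)"
  define z where "z t = d 1 * (exp (\<alpha> * t) - 1)" for t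
  \<comment> \<open>The excess over \<open>z\<close>, followed backwards from \<open>b\<close>. The
    weight offsets the linear growth rate \<open>\<alpha>\<close>, so a positive excess at
    \<open>b\<close> would survive down to 0, where \<open>U 0 \<le> 0\<close>.\<close>
  define h where "h s = exp (\<alpha> * s) * (U (b - s) - z (b - s))" for s
  have "h 0 \<le> h b"
  proof (rule positive_imp_nondecreasing[of 0 b h])
    show "continuous_on {0..b} h"
      unfolding h_def z_def using assms
      by (intro continuous_intros continuous_on_compose2[OF continuous_on_U]) auto
    show "0 < h 0" using less by (simp add: h_def z_def)
    fix s assume s: "0 < s" "s < b" "0 < h s"
    define t where "t = b - s"
    have t: "0 < t" "t < n" using s assms by (auto simp: t_def)
    have pos: "0 < U t - z t" using s by (simp add: h_def t_def zero_less_mult_iff)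
    have z_nonneg: "0 \<le> z t" using t \<alpha> d_nonneg[of 1] by (simp add: z_def)
    define U' where "U' = \<alpha> * (d (clamped_inv n (U t)) - d t)"
    have "(U has_real_derivative U') (at t)" unfolding U'_def using t by (intro U_deriv)
    then have "((\<lambda>s. U (b - s)) has_real_derivative U' * - 1) (at s)"
      unfolding t_def by (rule DERIV_chain2) (auto intro!: derivative_eq_intros)
    then have "(h has_real_derivative
        exp (\<alpha> * s) * (\<alpha> * (U t - z t) - (U' - \<alpha> * (d 1 + z t)))) (at s)"
      unfolding h_def z_def t_def
      by (auto intro!: derivative_eq_intros simp: algebra_simps)
    moreover have "U' \<le> \<alpha> * (d 1 + U t)"
      unfolding U'_def using price_clamped_inv_le[OF n, of "U t"] pos z_nonneg d_nonneg[of t] t \<alpha>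
      by (intro mult_left_mono) auto
    then have "0 \<le> exp (\<alpha> * s) * (\<alpha> * (U t - z t) - (U' - \<alpha> * (d 1 + z t)))"
      by (intro mult_nonneg_nonneg) (auto simp: algebra_simps)
    ultimately show "\<exists>l\<ge>0. (h has_real_derivative l) (at s)" by blast
  qed (use assms in auto)
  moreover have "h b \<le> 0"
    using assms by (simp add: h_def z_def mult_le_0_iff)
  moreover have "0 < h 0" using less by (simp add: h_def z_def)
  ultimately show False by simp
qed

text \<open>On \<open>[b, b + 1]\<close> the reserve price is at least \<open>d (b + 2)\<close> and
  the marginal cost at most \<open>d (b + 1)\<close>, so \<open>U\<close> still has to rise by a
  fixed amount before \<open>b + 1\<close>, yet never exceeds \<open>leg n\<close>. The gap does not
  depend on \<open>n\<close>.\<close>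

lemma U_below_top:
  assumes "0 < b" "b + 2 \<le> n" and large: "leg (b + 2) < U b"
  shows "U b \<le> leg n - \<alpha> * (d (b + 2) - d (b + 1))"
proof -
  define \<kappa> where "\<kappa> = \<alpha> * (d (b + 2) - d (b + 1))"
  have "U b - \<kappa> * b \<le> U (b + 1) - \<kappa> * (b + 1)"
  proof (rule DERIV_nonneg_imp_increasing_open[of b "b + 1" "\<lambda>t. U t - \<kappa> * t"])
    show "continuous_on {b..b + 1} (\<lambda>t. U t - \<kappa> * t)"
      using assms by (intro continuous_intros continuous_on_subset[OF continuous_on_U]) auto
    fix t assume t: "b < t" "t < b + 1"
    have "leg (b + 2) \<le> U t" using U_mono[of b t] t assms by simp
    then have "d (b + 2) \<le> d (clamped_inv n (U t))"
      using assms n by (intro d_mono le_clamped_inv) auto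
    moreover have "d t \<le> d (b + 1)" using t assms by (intro d_mono) auto
    ultimately have "\<kappa> \<le> \<alpha> * (d (clamped_inv n (U t)) - d t)"
      unfolding \<kappa>_def using \<alpha> by (intro mult_left_mono) auto
    moreover have "((\<lambda>t. U t - \<kappa> * t) has_real_derivative
        \<alpha> * (d (clamped_inv n (U t)) - d t) - \<kappa>) (at t)"
      using U_deriv[of t] t assms by (auto intro!: derivative_eq_intros)
    ultimately show "\<exists>l. ((\<lambda>t. U t - \<kappa> * t) has_real_derivative l) (at t) \<and> 0 \<le> l"
      by (metis diff_ge_0_iff_ge)
  qed simp
  moreover have "U (b + 1) \<le> leg n" using assms by (intro U_le) auto
  ultimately show ?thesis unfolding \<kappa>_def[symmetric] by (simp add: algebra_simps)
qed

text \<open>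
  What an algorithm gains by raising its load from \<open>a\<close> to \<open>b\<close> at a price not exceeding the
  reserve price at \<open>a\<close>. Beyond load \<open>n\<close> such a price is at most marginal cost.
\<close>

lemma gain_le:
  assumes "0 \<le> a" "a \<le> b" "0 \<le> q" "q \<le> n" "leg q \<le> U (min a n)"
  shows "\<alpha> * (d q * (b - a) - (f b - f a)) \<le> U (min b n) - U (min a n)"
proof -
  \<comment> \<open>As long as \<open>leg q \<le> U t\<close>, the price \<open>d q\<close> is at
    most the reserve price, so \<open>U\<close> grows at least as fast as \<open>\<alpha>\<close>
    times the surplus.\<close>
  have below: "\<alpha> * (d q * (b - a) - (f b - f a)) \<le> U b - U a"
    if ab: "0 \<le> a" "a \<le> b" "b \<le> n" "leg q \<le> U a" for a b
  proof -
    have "U a - \<alpha> * (d q * a - f a) \<le> U b - \<alpha> * (d q * b - f b)"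
    proof (rule DERIV_nonneg_imp_increasing_open[of a b "\<lambda>t. U t - \<alpha> * (d q * t - f t)"])
      show "continuous_on {a..b} (\<lambda>t. U t - \<alpha> * (d q * t - f t))"
        using ab by (intro continuous_intros continuous_on_subset[OF continuous_on_U]
            continuous_on_subset[OF continuous_on_f]) auto
      fix t assume t: "a < t" "t < b"
      have "leg q \<le> U t" using U_mono[of a t] t ab by simp
      then have "d q \<le> d (clamped_inv n (U t))"
        using assms n by (intro d_mono le_clamped_inv) auto
      then have "0 \<le> \<alpha> * (d (clamped_inv n (U t)) - d t) - \<alpha> * (d q - d t)"
        using \<alpha> by (simp flip: right_diff_distrib)
      moreover have "((\<lambda>t. U t - \<alpha> * (d q * t - f t)) has_real_derivative
          \<alpha> * (d (clamped_inv n (U t)) - d t) - \<alpha> * (d q - d t)) (at t)"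
        using U_deriv[of t] f_deriv_at[of t] t ab by (auto intro!: derivative_eq_intros)
      ultimately show "\<exists>l. ((\<lambda>t. U t - \<alpha> * (d q * t - f t)) has_real_derivative l) (at t) \<and> 0 \<le> l"
        by blast
    qed (use ab in auto)
    then show ?thesis by (simp add: algebra_simps)
  qed
  have above: "d q * (b - a) - (f b - f a) \<le> 0" if ab: "n \<le> a" "a \<le> b" for a b
  proof -
    have "d q * (b - a) \<le> d a * (b - a)"
      using assms ab n by (intro mult_right_mono d_mono) auto
    also have "\<dots> \<le> f b - f a" using f_above_tangent[of a b] ab n by simp
    finally show ?thesis by simp
  qed
  consider "b \<le> n" | "a \<le> n" "n \<le> b" | "n \<le> a" by linarith
  then show ?thesis
  proof cases
    case 1
    then show ?thesis using below[of a b] assms by (simp add: min_def)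
  next
    case 2
    have "\<alpha> * (d q * (b - n) - (f b - f n)) \<le> 0"
      using above[of n b] 2 \<alpha> by (simp add: mult_le_0_iff)
    moreover have "\<alpha> * (d q * (n - a) - (f n - f a)) \<le> U n - U a"
      using below[of a n] 2 assms by (simp add: min_def split: if_splits)
    ultimately show ?thesis using 2 by (simp add: algebra_simps min_def)
  next
    case 3
    then have "\<alpha> * (d q * (b - a) - (f b - f a)) \<le> 0"
      using above[of a b] assms \<alpha> by (simp add: mult_le_0_iff)
    with 3 assms show ?thesis by (simp add: min_absorb2)
  qed
qed

end

subsection \<open>Lower bound and limit\<close>

context convex_cost
begin

text \<open>\<open>OPT\<close> is a supremum of reals, so boundedness is required: the total value
  bounds the objective, as costs are nonnegative and allocations at most 1.\<close>

lemma objective_le_OPT: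
  assumes I: "valid_instance I" and x: "\<And>t. t < length I \<Longrightarrow> x t \<in> allocations"
  shows "objective f I x \<le> OPT f I"
  unfolding OPT_def
proof (rule cSUP_upper)
  show "x \<in> {x. \<forall>t<length I. x t \<in> allocations}" using x by simp
  show "bdd_above (objective f I ` {x. \<forall>t<length I. x t \<in> allocations})"
  proof (rule bdd_aboveI2)
    fix z assume "z \<in> {x :: nat \<Rightarrow> real ^ 'a. \<forall>t<length I. x t \<in> allocations}"
    then have z: "z t \<in> allocations" if "t < length I" for t using that by simp
    have "0 \<le> f (\<Sum>t<length I. snd (I ! t) $ j * z t $ j)" for j
      using I z by (intro f_nonneg sum_nonneg mult_nonneg_nonneg)
        (auto simp: valid_instanceD less_imp_le allocations_nonneg)
    then have "0 \<le> (\<Sum>j\<in>UNIV. f (\<Sum>t<length I. snd (I ! t) $ j * z t $ j))"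
      by (intro sum_nonneg)
    moreover have "(\<Sum>t<length I. \<Sum>j\<in>UNIV. fst (I ! t) $ j * z t $ j)
        \<le> (\<Sum>t<length I. \<Sum>j\<in>UNIV. fst (I ! t) $ j)"
      using I z by (intro sum_mono mult_left_le)
        (auto simp: valid_instanceD allocations_le_1)
    ultimately show "objective f I z \<le> (\<Sum>t<length I. \<Sum>j\<in>UNIV. fst (I ! t) $ j)"
      by (simp add: objective_def)
  qed
qed

text \<open>
  In the instances behind this lemma only one node has value. All demands have size \<open>W\<close>, so the
  last demand alone can carry the offline optimal load \<open>q k\<close> at its price \<open>d (q k)\<close>.
\<close>

lemma competitive_single_node_loads:
  fixes A :: "'m::finite arrival list \<Rightarrow> real ^ 'm"
  assumes A: "competitive \<alpha> f A" and \<alpha>: "0 \<le> \<alpha>"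
    and W: "0 < W" and q: "\<And>k. k < N \<Longrightarrow> 0 \<le> q k \<and> q k \<le> W"
  obtains y :: "nat \<Rightarrow> real"
    where "y 0 = 0" and "\<And>k. k < N \<Longrightarrow> y k \<le> y (Suc k)"
      and "\<And>k. k < N \<Longrightarrow>
        leg (q k) \<le> \<alpha> * ((\<Sum>t\<le>k. d (q t) * (y (Suc t) - y t)) - f (y (Suc k)))"
proof -
  define j0 :: 'm where "j0 = undefined"
  \<comment> \<open>Value \<open>d (q t) * W\<close> at size \<open>W\<close> amounts to a price of
    \<open>d (q t)\<close> per unit of load.\<close>
  define arr :: "nat \<Rightarrow> 'm arrival"
    where "arr t = (\<chi> j. if j = j0 then d (q t) * W else 0, \<chi> j. W)" for t
  define I where "I = map arr [0..<N]"
  define x where "x = run A I"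
  define y where "y k = (\<Sum>t<k. W * x t $ j0)" for k
  have valid: "valid_instance (take k I)" for k
    using W q by (auto simp: valid_instance_def I_def arr_def d_nonneg dest!: in_set_takeD)
  have nth: "take k I ! t = arr t" if "t < k" "k \<le> N" for t k
    using that by (simp add: I_def)
  have length: "length (take k I) = k" if "k \<le> N" for k
    using that by (simp add: I_def)
  have run: "run A (take k I) t = x t" if "t < k" for t k
    using that by (simp add: run_def x_def min_def)
  have online: "A J \<in> allocations" if "valid_instance J" "J \<noteq> []" for J
    using A that by (auto simp: competitive_def online_algorithm_def)
  have xa: "x t \<in> allocations" if "t < N" for t
    unfolding x_def run_def using that by (intro online valid) (auto simp: I_def)
  show thesis
  proof (rule that)
    show "y 0 = 0" by (simp add: y_def)
    show "y k \<le> y (Suc k)" if "k < N" for k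
      using W allocations_nonneg[OF xa[OF that], of j0] by (simp add: y_def)
    fix k assume k: "k < N"
    \<comment> \<open>An online algorithm acts on each prefix as on \<open>I\<close>, so
      competitiveness on the prefixes constrains one and the same load sequence for every
      \<open>k\<close>.\<close>
    define J where "J = take (Suc k) I"
    have J: "length J = Suc k" "\<And>t. t < Suc k \<Longrightarrow> J ! t = arr t"
      "\<And>t. t < Suc k \<Longrightarrow> run A J t = x t"
      using length[of "Suc k"] nth[of _ "Suc k"] run[of _ "Suc k"] k by (auto simp: J_def)
    have objective_J: "objective f J z = (\<Sum>t<Suc k. \<Sum>j\<in>UNIV. fst (arr t) $ j * z' t $ j)
        - (\<Sum>j\<in>UNIV. f (\<Sum>t<Suc k. snd (arr t) $ j * z' t $ j))"
      if "\<And>t. t < Suc k \<Longrightarrow> z t = z' t" for z z'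
      unfolding objective_def J(1) using J(2) that
      by (intro arg_cong2[where f = "(-)"] sum.cong arg_cong[where f = f]) auto
    define z :: "nat \<Rightarrow> real ^ 'm"
      where "z t = (\<chi> j. if t = k \<and> j = j0 then q k / W else 0)" for t
    have "leg (q k) = objective f J z"
    proof -
      have "(\<Sum>t<Suc k. \<Sum>j\<in>UNIV. fst (arr t) $ j * z t $ j) = q k * d (q k)"
      proof -
        have "(\<Sum>j\<in>UNIV. fst (arr t) $ j * z t $ j) = (if t = k then q k * d (q k) else 0)" for t
        proof -
          have "(\<Sum>j\<in>UNIV. fst (arr t) $ j * z t $ j) =
              (\<Sum>j\<in>UNIV. if j = j0 then (if t = k then q k * d (q k) else 0) else 0)"
            using W by (intro sum.cong) (auto simp: arr_def z_def)
          then show ?thesis by simp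
        qed
        then show ?thesis by simp
      qed
      moreover have "(\<Sum>j\<in>UNIV. f (\<Sum>t<Suc k. snd (arr t) $ j * z t $ j)) = f (q k)"
      proof -
        have "(\<Sum>t<Suc k. snd (arr t) $ j * z t $ j) = (if j = j0 then q k else 0)" for j
        proof -
          have "(\<Sum>t<Suc k. snd (arr t) $ j * z t $ j)
              = (\<Sum>t<Suc k. if t = k then (if j = j0 then q k else 0) else 0)"
            using W by (intro sum.cong) (auto simp: arr_def z_def)
          then show ?thesis by simp
        qed
        then have "(\<Sum>j\<in>UNIV. f (\<Sum>t<Suc k. snd (arr t) $ j * z t $ j))
            = (\<Sum>j\<in>UNIV. if j = j0 then f (q k) else 0)"
          by (intro sum.cong) (auto simp: f_0)
        then show ?thesis by simp
      qed
      ultimately show ?thesis by (simp only: objective_J leg_def)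
    qed
    also have "\<dots> \<le> OPT f J"
    proof (rule objective_le_OPT)
      show "valid_instance J" unfolding J_def by (rule valid)
      fix t
      have "(\<Sum>j\<in>UNIV. z t $ j) = (\<Sum>j\<in>UNIV. if j = j0 then (if t = k then q k / W else 0) else 0)"
        by (intro sum.cong) (auto simp: z_def)
      then show "z t \<in> allocations"
        using q[OF k] W by (auto simp: allocations_def z_def)
    qed
    also have "\<dots> \<le> \<alpha> * ALG f A J"
      using A valid by (simp add: competitive_def J_def)
    also have "\<dots> \<le> \<alpha> * ((\<Sum>t\<le>k. d (q t) * (y (Suc t) - y t)) - f (y (Suc k)))"
    proof (intro mult_left_mono \<alpha>)
      have "(\<Sum>j\<in>UNIV. fst (arr t) $ j * x t $ j) = d (q t) * (y (Suc t) - y t)" for t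
      proof -
        have "(\<Sum>j\<in>UNIV. fst (arr t) $ j * x t $ j)
            = (\<Sum>j\<in>UNIV. if j = j0 then d (q t) * (y (Suc t) - y t) else 0)"
          by (intro sum.cong) (auto simp: arr_def y_def)
        then show ?thesis by simp
      qed
      \<comment> \<open>The other nodes bring no value, and their costs are nonnegative.\<close>
      moreover have "f (y (Suc k)) \<le> (\<Sum>j\<in>UNIV. f (\<Sum>t<Suc k. snd (arr t) $ j * x t $ j))"
      proof -
        have "f (y (Suc k)) = f (\<Sum>t<Suc k. snd (arr t) $ j0 * x t $ j0)"
          by (simp add: y_def arr_def)
        also have "\<dots> \<le> (\<Sum>j\<in>UNIV. f (\<Sum>t<Suc k. snd (arr t) $ j * x t $ j))"
          using W k xa
          by (intro member_le_sum f_nonneg sum_nonneg mult_nonneg_nonneg)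
             (auto simp: arr_def allocations_nonneg)
        finally show ?thesis .
      qed
      ultimately show "ALG f A J \<le> (\<Sum>t\<le>k. d (q t) * (y (Suc t) - y t)) - f (y (Suc k))"
        using objective_J[of "run A J" x] J(3) by (simp add: ALG_def lessThan_Suc_atMost)
    qed
    finally show "leg (q k) \<le> \<alpha> * ((\<Sum>t\<le>k. d (q t) * (y (Suc t) - y t)) - f (y (Suc k)))" .
  qed
qed

end

context backward
begin

text \<open>
  If \<open>U\<close> reached \<open>0\<close> with a surplus \<open>U 0 > 0\<close>, prices could be raised in steps of \<open>leg\<close> not
  exceeding the surplus, each below the reserve price at the current load. By \<open>gain_le\<close> the
  algorithm then never catches up with \<open>U\<close>, and at price \<open>d n\<close> it is not competitive.
\<close>

lemma U_0_le_0_of_competitive: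
  fixes A :: "'m::finite arrival list \<Rightarrow> real ^ 'm"
  assumes A: "competitive \<alpha> f A"
  shows "U 0 \<le> 0"
proof (rule ccontr)
  assume "\<not> U 0 \<le> 0"
  then have pos: "0 < U 0" by simp
  have g: "0 < leg n" using leg_strict_mono[of 0 n] n by simp
  \<comment> \<open>\<open>N\<close> equal steps of \<open>leg\<close> from 0 to
    \<open>leg n\<close> have size at most the surplus \<open>U 0\<close>.\<close>
  obtain N :: nat where N: "leg n / U 0 < real N" using reals_Archimedean2 by blast
  have N_pos: "0 < N" using N pos g by (metis divide_pos_pos less_trans of_nat_0_less_iff)
  have step: "leg n / N \<le> U 0" using N N_pos pos by (simp add: field_simps)
  have "\<exists>q. 0 \<le> q \<and> q \<le> n \<and> leg q = real (Suc k) * (leg n / N)" if "k < N" for k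
  proof -
    have "real (Suc k) * (leg n / N) \<le> real N * (leg n / N)"
      using that g by (intro mult_right_mono) auto
    then have "real (Suc k) * (leg n / N) \<le> leg n" using N_pos by simp
    moreover have "leg 0 \<le> real (Suc k) * (leg n / N)" using g by simp
    ultimately show ?thesis using leg_intermediate[of 0 n] n by (metis order_trans zero_le_one order_refl)
  qed
  then obtain q where q: "\<And>k. k < N \<Longrightarrow> 0 \<le> q k \<and> q k \<le> n"
    and leg_q: "\<And>k. k < N \<Longrightarrow> leg (q k) = real (Suc k) * (leg n / N)"
    by metis
  obtain y where y_0: "y 0 = 0" and y_step: "\<And>k. k < N \<Longrightarrow> y k \<le> y (Suc k)"
    and gain: "\<And>k. k < N \<Longrightarrow>
        leg (q k) \<le> \<alpha> * ((\<Sum>t\<le>k. d (q t) * (y (Suc t) - y t)) - f (y (Suc k)))"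
    by (rule competitive_single_node_loads[OF A, of n N q]) (use \<alpha> n q in auto)
  \<comment> \<open>Surplus of the node after \<open>k\<close> arrivals: competitiveness bounds it
    from below, \<open>gain_le\<close> from above.\<close>
  define S where "S k = (\<Sum>t<k. d (q t) * (y (Suc t) - y t)) - f (y k)" for k
  have leg_le: "real k * (leg n / N) \<le> \<alpha> * S k" if "k \<le> N" for k
  proof (cases k)
    case (Suc m)
    then show ?thesis using gain[of m] leg_q[of m] that
      by (simp add: S_def lessThan_Suc_atMost)
  qed (simp add: S_def y_0 f_0)
  have y_nonneg: "0 \<le> y k" if "k \<le> N" for k
    using that
  proof (induction k)
    case (Suc k)
    then show ?case using y_step[of k] by simp
  qed (simp add: y_0)
  have S_le: "\<alpha> * S k \<le> U (min (y k) n) - U 0" if "k \<le> N" for k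
    using that
  proof (induction k)
    case 0
    then show ?case using n by (simp add: S_def y_0 f_0)
  next
    case (Suc k)
    then have k: "k < N" by simp
    \<comment> \<open>Competitiveness before arrival \<open>k\<close> and the induction hypothesis
      show that the next price does not exceed the reserve price at the current load, as
      \<open>gain_le\<close> requires.\<close>
    have "leg (q k) \<le> real k * (leg n / N) + U 0"
      using leg_q[OF k] step by (simp add: distrib_right add_divide_distrib)
    also have "\<dots> \<le> U (min (y k) n)"
      using leg_le[of k] Suc by simp
    finally have "\<alpha> * (d (q k) * (y (Suc k) - y k) - (f (y (Suc k)) - f (y k)))
        \<le> U (min (y (Suc k)) n) - U (min (y k) n)"
      using y_nonneg[of k] y_step[OF k] q[OF k] k by (intro gain_le) auto
    moreover have "S (Suc k) = S k + (d (q k) * (y (Suc k) - y k) - (f (y (Suc k)) - f (y k)))"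
      by (simp add: S_def)
    ultimately show ?case using Suc by (simp add: distrib_left)
  qed
  have "leg n \<le> U (min (y N) n) - U 0"
    using leg_le[of N] S_le[of N] N_pos by simp
  also have "\<dots> \<le> leg n - U 0"
    using U_le[of "min (y N) n"] y_nonneg[of N] n by simp
  finally show False using pos by simp
qed

end

section \<open>Uniform bounds and passage to the limit\<close>

context convex_cost
begin

text \<open>The bound has the form \<open>leg M\<close> because the limit must stay in the range of
  \<open>leg\<close>, which may be bounded. If \<open>leg\<close> reaches the Gronwall bound
  \<open>B\<close>, then \<open>U_le_exp\<close> suffices.\<close>

lemma backward_solutions_bounded:
  assumes "1 \<le> \<alpha>" "0 < b"
  obtains M where "b + 2 \<le> M"
    and "\<And>n U. backward f \<alpha> n U \<Longrightarrow> U 0 \<le> 0 \<Longrightarrow> b + 2 \<le> n \<Longrightarrow> U b \<le> leg M"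
proof -
  define B where "B = d 1 * (exp (\<alpha> * b) - 1)"
  define \<kappa> where "\<kappa> = \<alpha> * (d (b + 2) - d (b + 1))"
  have \<kappa>: "0 < \<kappa>" using assms d_strict_mono[of "b + 1" "b + 2"] by (simp add: \<kappa>_def)
  show thesis
  proof (cases "\<exists>M\<ge>b + 2. B \<le> leg M")
    case True
    then obtain M where M: "b + 2 \<le> M" "B \<le> leg M" by blast
    show thesis
    proof (rule that[OF M(1)])
      fix n U assume "backward f \<alpha> n U" "U 0 \<le> 0" "b + 2 \<le> n"
      then show "U b \<le> leg M"
        using backward.U_le_exp[of f \<alpha> n U b] assms M by (simp add: B_def)
    qed
  next
    case False
    text \<open>Here \<open>leg\<close> is bounded, and \<open>U_below_top\<close> keeps \<open>U b\<close> away from its supremum.\<close>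
    then have bdd: "bdd_above (leg ` {b + 2..})" by (intro bdd_aboveI2[of _ _ B]) auto
    have "Sup (leg ` {b + 2..}) - \<kappa> < Sup (leg ` {b + 2..})" using \<kappa> by simp
    \<comment> \<open>\<open>leg M\<close> lies within \<open>\<kappa>\<close> of the supremum,
      hence above \<open>leg n - \<kappa>\<close> for every \<open>n \<ge> b + 2\<close>.\<close>
    then obtain M where M: "b + 2 \<le> M" "Sup (leg ` {b + 2..}) - \<kappa> < leg M"
      by (subst (asm) less_cSup_iff[OF _ bdd]) auto
    show thesis
    proof (rule that[OF M(1)])
      fix n U assume U: "backward f \<alpha> n U" "b + 2 \<le> n"
      show "U b \<le> leg M"
      proof (cases "leg (b + 2) < U b")
        case True
        have "U b \<le> leg n - \<kappa>"
          using backward.U_below_top[OF U(1) assms(2) U(2) True] by (simp add: \<kappa>_def)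
        moreover have "leg n \<le> Sup (leg ` {b + 2..})"
          using U by (intro cSup_upper bdd) auto
        ultimately show ?thesis using M by simp
      next
        case False
        then show ?thesis using leg_mono[of "b + 2" M] M assms by simp
      qed
    qed
  qed
qed

text \<open>From some index on, the values at \<open>y\<close> increase and lie between
  \<open>leg y\<close> and \<open>leg M\<close>; by the intermediate value theorem their limit is a
  value of \<open>leg\<close>.\<close>

lemma reserve_limit:
  assumes \<alpha>: "1 \<le> \<alpha>"
    and U: "\<And>k. backward f \<alpha> (real (Suc k)) (U k)"
    and U_0: "\<And>k. U k 0 \<le> 0"
    and y: "0 < y"
  shows "\<exists>q\<ge>y. (\<lambda>k. U k y) \<longlonglongrightarrow> leg q"
proof -
  obtain M where M: "y + 2 \<le> M"
    "\<And>n U. backward f \<alpha> n U \<Longrightarrow> U 0 \<le> 0 \<Longrightarrow> y + 2 \<le> n \<Longrightarrow> U y \<le> leg M"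
    using backward_solutions_bounded[OF \<alpha> y] by blast
  obtain K :: nat where K: "max (1 / y) (y + 2) < real K" using reals_Archimedean2 by blast
  have large: "1 / real (Suc k) \<le> y" "y + 2 \<le> real (Suc k)" if "K \<le> k" for k
  proof -
    have "1 / y \<le> real (Suc k)" using K that by simp
    then show "1 / real (Suc k) \<le> y" using y by (simp add: field_simps)
    show "y + 2 \<le> real (Suc k)" using K that by simp
  qed
  have lower: "leg y \<le> U k y" and upper: "U k y \<le> leg M" if "K \<le> k" for k
    using backward.leg_le_U[OF U, of k y] M(2)[OF U U_0, of k] large[OF that] by auto
  have incr: "U k y \<le> U (Suc k) y" if "K \<le> k" for k
    using backward.U_le_of_larger[OF U U, of k "Suc k" y] large[OF that] by auto
  have "incseq (\<lambda>k. U (k + K) y)" using incr by (intro incseq_SucI) simp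
  then obtain L where L: "(\<lambda>k. U (k + K) y) \<longlonglongrightarrow> L"
    using incseq_convergent[of "\<lambda>k. U (k + K) y" "leg M"] upper by (metis le_add2)
  then have "(\<lambda>k. U k y) \<longlonglongrightarrow> L" by (rule LIMSEQ_offset)
  moreover have "leg y \<le> L" "L \<le> leg M"
    using LIMSEQ_le_const[OF L] LIMSEQ_le_const2[OF L] lower upper by (auto intro: exI[of _ 0])
  then obtain q where "y \<le> q" "leg q = L"
    using leg_intermediate[of y M L] y M(1) by auto
  ultimately show ?thesis by blast
qed

text \<open>Dominated convergence gives the integrated equation for the limit, the fundamental
  theorem of calculus differentiates \<open>leg \<circ> \<phi>\<close>, and inverting
  \<open>leg\<close> differentiates \<open>\<phi>\<close>.\<close>

lemma ex_reserve_function: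
  fixes A :: "'m::finite arrival list \<Rightarrow> real ^ 'm"
  assumes \<alpha>: "1 \<le> \<alpha>" and A: "competitive \<alpha> f A"
  shows "\<exists>\<phi>. reserve_function \<alpha> f \<phi>"
proof -
  have "\<exists>U. backward_solution \<alpha> (real (Suc k)) U" for k
    using \<alpha> by (intro ex_backward_solution) auto
  then obtain U where "\<And>k. backward_solution \<alpha> (real (Suc k)) (U k)" by metis
  then have U: "backward f \<alpha> (real (Suc k)) (U k)" for k
    using \<alpha> by unfold_locales auto
  have U_0: "U k 0 \<le> 0" for k
    using backward.U_0_le_0_of_competitive[OF U A] .
  obtain \<psi> where \<psi>: "\<And>y. 0 < y \<Longrightarrow> y \<le> \<psi> y" "\<And>y. 0 < y \<Longrightarrow> (\<lambda>k. U k y) \<longlonglongrightarrow> leg (\<psi> y)"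
    using reserve_limit[OF \<alpha> U U_0] by metis
  define \<phi> where "\<phi> y = (if 0 < y then \<psi> y else 0)" for y
  have \<phi>_ge: "y \<le> \<phi> y" and lim: "(\<lambda>k. U k y) \<longlonglongrightarrow> leg (\<phi> y)" if "0 < y" for y
    using \<psi>[of y] that by (auto simp: \<phi>_def)
  have \<phi>_0: "\<phi> 0 = 0" by (simp add: \<phi>_def)
  have \<phi>_nonneg: "0 \<le> \<phi> y" if "0 \<le> y" for y
    using \<phi>_ge[of y] that by (cases "y = 0") (auto simp: \<phi>_0)
  have exp_bound: "leg (\<phi> y) \<le> d 1 * (exp (\<alpha> * y) - 1)" if y: "0 < y" for y
  proof -
    obtain K :: nat where "y < real K" using reals_Archimedean2 by blast
    then have "U k y \<le> d 1 * (exp (\<alpha> * y) - 1)" if "K \<le> k" for k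
      using that y by (intro backward.U_le_exp[OF U U_0]) auto
    then show ?thesis using LIMSEQ_le_const2[OF lim[OF y]] by blast
  qed
  \<comment> \<open>Since \<open>a > 0\<close>, for large indices the clamp is inactive on all of
    \<open>[a, b]\<close>.\<close>
  have integral: "(\<lambda>t. \<alpha> * (d (\<phi> t) - d t)) integrable_on {a..b}"
    "leg (\<phi> b) - leg (\<phi> a) = integral {a..b} (\<lambda>t. \<alpha> * (d (\<phi> t) - d t))"
    if a: "0 < a" and ab: "a \<le> b" for a b
  proof -
    have b: "0 < b" using a ab by simp
    obtain M where M: "b + 2 \<le> M"
      "\<And>n U. backward f \<alpha> n U \<Longrightarrow> U 0 \<le> 0 \<Longrightarrow> b + 2 \<le> n \<Longrightarrow> U b \<le> leg M"
      using backward_solutions_bounded[OF \<alpha> b] by blast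
    obtain K :: nat where K: "max (1 / a) (b + 2) < real K" using reals_Archimedean2 by blast
    define n where "n k = real (Suc (k + K))" for k
    define V where "V k = U (k + K)" for k
    have V: "backward f \<alpha> (n k) (V k)" for k unfolding n_def V_def by (rule U)
    have n: "1 \<le> n k" "b + 2 \<le> n k" "1 / n k \<le> a" for k
    proof -
      show "1 \<le> n k" "b + 2 \<le> n k" using K by (auto simp: n_def)
      have "1 / a \<le> n k" using K by (simp add: n_def)
      then show "1 / n k \<le> a" using a \<open>1 \<le> n k\<close> by (simp add: field_simps)
    qed
    have V_lim: "(\<lambda>k. V k t) \<longlonglongrightarrow> leg (\<phi> t)" if "0 < t" for t
      unfolding V_def using lim[OF that] by (rule LIMSEQ_ignore_initial_segment)
    define F where "F k t = \<alpha> * (d (clamped_inv (n k) (V k t)) - d t)" for k t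
    have leg_inv: "leg (clamped_inv (n k) (V k t)) = V k t"
      and inv_ge: "t \<le> clamped_inv (n k) (V k t)"
      and inv_le: "clamped_inv (n k) (V k t) \<le> M" if t: "t \<in> {a..b}" for k t
    proof -
      show *: "leg (clamped_inv (n k) (V k t)) = V k t"
        using n[of k] t by (intro backward.leg_clamped_inv_U[OF V]) auto
      show "t \<le> clamped_inv (n k) (V k t)"
        using n[of k] t a by (intro backward.le_clamped_inv_U[OF V]) auto
      have "V k t \<le> V k b"
        using n[of k] t a by (intro backward.U_mono[OF V]) auto
      also have "\<dots> \<le> leg M"
        using M(2)[OF V] U_0 n[of k] by (simp add: V_def)
      finally have "leg (clamped_inv (n k) (V k t)) \<le> leg M" unfolding * .
      then show "clamped_inv (n k) (V k t) \<le> M"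
        using M(1) b n[of k] by (simp add: leg_le_iff clamped_inv_nonneg)
    qed
    have FTC: "(F k has_integral V k b - V k a) {a..b}" for k
    proof (intro fundamental_theorem_of_calculus ab)
      fix t assume t: "t \<in> {a..b}"
      have "(V k has_real_derivative F k t) (at t)"
        unfolding F_def using t a n[of k] by (intro backward.U_deriv[OF V]) auto
      then show "(V k has_vector_derivative F k t) (at t within {a..b})"
        by (simp add: has_real_derivative_iff_has_vector_derivative has_vector_derivative_at_within)
    qed
    \<comment> \<open>The inverses and \<open>\<phi> t\<close> are at least \<open>a\<close>, so
      \<open>d_lipschitz\<close> carries convergence of the \<open>leg\<close> values over to the
      prices.\<close>
    have F_lim: "(\<lambda>k. F k t) \<longlonglongrightarrow> \<alpha> * (d (\<phi> t) - d t)" if t: "t \<in> {a..b}" for t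
    proof -
      have "(\<lambda>k. d (clamped_inv (n k) (V k t))) \<longlonglongrightarrow> d (\<phi> t)"
      proof (rule LIM_zero_cancel, rule Lim_null_comparison)
        show "\<forall>\<^sub>F k in sequentially.
            norm (d (clamped_inv (n k) (V k t)) - d (\<phi> t)) \<le> 1 / a * \<bar>V k t - leg (\<phi> t)\<bar>"
        proof (intro always_eventually allI)
          fix k
          have "a * \<bar>d (clamped_inv (n k) (V k t)) - d (\<phi> t)\<bar>
              \<le> \<bar>leg (clamped_inv (n k) (V k t)) - leg (\<phi> t)\<bar>"
            using inv_ge[OF t, of k] \<phi>_ge[of t] t a by (intro d_lipschitz) auto
          then show "norm (d (clamped_inv (n k) (V k t)) - d (\<phi> t)) \<le> 1 / a * \<bar>V k t - leg (\<phi> t)\<bar>"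
            using a by (simp add: leg_inv[OF t] field_simps)
        qed
        have "(\<lambda>k. 1 / a * \<bar>V k t - leg (\<phi> t)\<bar>) \<longlonglongrightarrow> 1 / a * \<bar>leg (\<phi> t) - leg (\<phi> t)\<bar>"
          using t a by (intro tendsto_intros V_lim) auto
        then show "(\<lambda>k. 1 / a * \<bar>V k t - leg (\<phi> t)\<bar>) \<longlonglongrightarrow> 0" by simp
      qed
      then show ?thesis unfolding F_def by (intro tendsto_intros)
    qed
    \<comment> \<open>The bound \<open>M\<close> on the inverses is uniform in \<open>k\<close> and
      dominates the integrands.\<close>
    have bound: "norm (F k t) \<le> \<alpha> * d M" if t: "t \<in> {a..b}" for k t
    proof -
      have "d t \<le> d (clamped_inv (n k) (V k t))" "d (clamped_inv (n k) (V k t)) \<le> d M" "0 \<le> d t"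
        using inv_ge[OF t, of k] inv_le[OF t, of k] t a by (auto intro!: d_mono d_nonneg)
      then show ?thesis using \<alpha> by (simp add: F_def abs_mult)
    qed
    have int: "F k integrable_on {a..b}" for k using FTC by blast
    show "(\<lambda>t. \<alpha> * (d (\<phi> t) - d t)) integrable_on {a..b}"
      by (rule dominated_convergence(1)[OF int _ bound F_lim]) auto
    have "(\<lambda>k. integral {a..b} (F k)) \<longlonglongrightarrow> integral {a..b} (\<lambda>t. \<alpha> * (d (\<phi> t) - d t))"
      by (rule dominated_convergence(2)[OF int _ bound F_lim]) auto
    moreover have "integral {a..b} (F k) = V k b - V k a" for k
      using FTC by (rule integral_unique)
    moreover have "(\<lambda>k. V k b - V k a) \<longlonglongrightarrow> leg (\<phi> b) - leg (\<phi> a)"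
      using a b by (intro tendsto_diff V_lim)
    ultimately show "leg (\<phi> b) - leg (\<phi> a) = integral {a..b} (\<lambda>t. \<alpha> * (d (\<phi> t) - d t))"
      using LIMSEQ_unique by simp
  qed
  have leg_\<phi>_deriv: "((\<lambda>y. leg (\<phi> y)) has_real_derivative \<alpha> * (d (\<phi> y) - d y)) (at y)"
    if y: "0 < y" for y
  proof -
    define a where "a = y / 2"
    define b where "b = y + 1"
    have ab: "0 < a" "a < y" "y < b" using y by (auto simp: a_def b_def)
    define H where "H t = \<alpha> * (d (\<phi> t) - d t)" for t
    have leg_eq: "leg (\<phi> t) = leg (\<phi> a) + integral {a..t} H" if "t \<in> {a..b}" for t
      using integral(2)[of a t] ab that by (simp add: H_def[abs_def])
    have "continuous_on {a..b} (\<lambda>t. leg (\<phi> a) + integral {a..t} H)"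
      using integral(1)[of a b] ab
      by (intro continuous_intros indefinite_integral_continuous_1) (auto simp: H_def[abs_def])
    then have cont_leg: "continuous_on {a..b} (\<lambda>t. leg (\<phi> t))"
      by (rule continuous_on_eq) (rule leg_eq[symmetric])
    \<comment> \<open>So far only \<open>leg \<circ> \<phi>\<close> is known to be continuous;
      \<open>d_lipschitz\<close> transfers this to the price, making the integrand
      continuous.\<close>
    have "continuous_on {a..b} (\<lambda>t. d (\<phi> t))"
      unfolding continuous_on_def
    proof (intro ballI, rule LIM_zero_cancel, rule Lim_null_comparison)
      fix s assume s: "s \<in> {a..b}"
      show "\<forall>\<^sub>F t in at s within {a..b}. norm (d (\<phi> t) - d (\<phi> s)) \<le> 1 / a * \<bar>leg (\<phi> t) - leg (\<phi> s)\<bar>"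
        unfolding eventually_at_filter
      proof (intro always_eventually allI impI)
        fix t assume "t \<in> {a..b}"
        then have "a * \<bar>d (\<phi> t) - d (\<phi> s)\<bar> \<le> \<bar>leg (\<phi> t) - leg (\<phi> s)\<bar>"
          using s ab \<phi>_ge[of t] \<phi>_ge[of s] by (intro d_lipschitz) auto
        then show "norm (d (\<phi> t) - d (\<phi> s)) \<le> 1 / a * \<bar>leg (\<phi> t) - leg (\<phi> s)\<bar>"
          using ab by (simp add: field_simps)
      qed
      have "((\<lambda>t. 1 / a * \<bar>leg (\<phi> t) - leg (\<phi> s)\<bar>) \<longlongrightarrow> 1 / a * \<bar>leg (\<phi> s) - leg (\<phi> s)\<bar>)
          (at s within {a..b})"
        using cont_leg s by (intro tendsto_intros) (auto simp: continuous_on_def)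
      then show "((\<lambda>t. 1 / a * \<bar>leg (\<phi> t) - leg (\<phi> s)\<bar>) \<longlongrightarrow> 0) (at s within {a..b})" by simp
    qed
    then have "continuous_on {a..b} H"
      unfolding H_def using ab
      by (intro continuous_intros continuous_on_subset[OF continuous_on_d]) auto
    then have "((\<lambda>t. integral {a..t} H) has_real_derivative H y) (at y within {a..b})"
      using ab by (intro integral_has_real_derivative) auto
    then have "((\<lambda>t. integral {a..t} H) has_real_derivative H y) (at y)"
      using ab at_within_interior[of y "{a..b}"] by simp
    then have "((\<lambda>t. leg (\<phi> a) + integral {a..t} H) has_real_derivative H y) (at y)"
      by (auto intro!: derivative_eq_intros)
    moreover have "\<forall>\<^sub>F t in nhds y. leg (\<phi> t) = leg (\<phi> a) + integral {a..t} H"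
    proof -
      have "\<forall>\<^sub>F t in nhds y. t \<in> {a<..<b}"
        using ab by (intro eventually_nhds_in_open) auto
      then show ?thesis by (rule eventually_mono) (auto intro: leg_eq)
    qed
    ultimately show ?thesis
      by (simp add: DERIV_cong_ev H_def)
  qed
  have \<phi>_deriv: "(\<phi> has_real_derivative \<alpha> * ((d (\<phi> y) - d y) / (\<phi> y * d2 (\<phi> y)))) (at y)"
    if y: "0 < y" for y
  proof -
    \<comment> \<open>\<open>\<phi>\<close> is recovered as the inverse of \<open>leg\<close>
      applied to \<open>leg \<circ> \<phi>\<close>, whose derivative is known;
      \<open>leg' = q * d2 q\<close> is nonzero at \<open>q = \<phi> y\<close>.\<close>
    define inv_leg where "inv_leg = inv_into {0..} leg"
    have inj: "inj_on leg {0..}"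
      by (rule inj_onI) (metis atLeast_iff leg_le_iff order_antisym order_refl)
    have inv_leg: "inv_leg (leg q) = q" if "0 \<le> q" for q
      unfolding inv_leg_def using that by (intro inv_into_f_f inj) auto
    have pos: "0 < \<phi> y" using \<phi>_ge y by force
    have "(inv_leg has_real_derivative inverse (\<phi> y * d2 (\<phi> y))) (at (leg (\<phi> y)))"
    proof (rule DERIV_inverse_function[where f = leg and a = 0 and b = "leg (\<phi> y + 1)"])
      show "(leg has_real_derivative \<phi> y * d2 (\<phi> y)) (at (inv_leg (leg (\<phi> y))))"
        using leg_deriv pos inv_leg by simp
      show "\<phi> y * d2 (\<phi> y) \<noteq> 0" using pos d2_pos[of "\<phi> y"] by simp
      show "0 < leg (\<phi> y)" using leg_strict_mono[of 0 "\<phi> y"] pos by simp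
      show "leg (\<phi> y) < leg (\<phi> y + 1)" using leg_strict_mono[of "\<phi> y" "\<phi> y + 1"] pos by simp
      fix v assume v: "0 < v" "v < leg (\<phi> y + 1)"
      then obtain q where "0 \<le> q" "leg q = v"
        using leg_intermediate[of 0 "\<phi> y + 1" v] pos by auto
      then show "leg (inv_leg v) = v" using inv_leg by auto
    next
      show "isCont inv_leg (leg (\<phi> y))"
      proof (rule isCont_inverse_function2[of "\<phi> y / 2" "\<phi> y" "\<phi> y + 1"])
        fix z assume "\<phi> y / 2 \<le> z" "z \<le> \<phi> y + 1"
        then have "0 < z" using pos by simp
        then show "inv_leg (leg z) = z" "isCont leg z"
          using inv_leg leg_deriv[of z] by (auto intro: DERIV_isCont)
      qed (use pos in auto)
    qed
    from DERIV_chain2[OF this leg_\<phi>_deriv[OF y]]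
    have "((\<lambda>y. inv_leg (leg (\<phi> y))) has_real_derivative
        \<alpha> * ((d (\<phi> y) - d y) / (\<phi> y * d2 (\<phi> y)))) (at y)"
      by (simp add: field_simps)
    moreover have "\<forall>\<^sub>F t in nhds y. inv_leg (leg (\<phi> t)) = \<phi> t"
    proof -
      have "\<forall>\<^sub>F t in nhds y. t \<in> {0<..}"
        using y by (intro eventually_nhds_in_open) auto
      then show ?thesis by (rule eventually_mono) (auto intro!: inv_leg \<phi>_nonneg)
    qed
    ultimately show ?thesis by (simp add: DERIV_cong_ev)
  qed
  \<comment> \<open>The Gronwall bound on \<open>leg (\<phi> y)\<close> vanishes as \<open>y\<close>
    tends to 0, and \<open>leg\<close> is strictly increasing.\<close>
  have "(\<phi> \<longlongrightarrow> 0) (at_right 0)"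
  proof (rule tendstoI)
    fix e :: real assume e: "0 < e"
    have "((\<lambda>y. d 1 * (exp (\<alpha> * y) - 1)) \<longlongrightarrow> d 1 * (exp (\<alpha> * 0) - 1)) (at_right 0)"
      by (intro tendsto_intros)
    then have "\<forall>\<^sub>F y in at_right 0. d 1 * (exp (\<alpha> * y) - 1) < leg e"
      using leg_strict_mono[of 0 e] e by (intro order_tendstoD(2)) auto
    moreover have "\<forall>\<^sub>F y in at_right (0 :: real). 0 < y" by (rule eventually_at_right_less)
    ultimately show "\<forall>\<^sub>F y in at_right 0. dist (\<phi> y) 0 < e"
    proof eventually_elim
      case (elim y)
      then have "leg (\<phi> y) < leg e" using exp_bound[of y] by simp
      then show ?case using elim e \<phi>_nonneg[of y] by (simp add: leg_less_iff)
    qed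
  qed
  then have cont_0: "continuous (at 0 within {0..}) \<phi>"
    by (simp add: continuous_within at_within_Ici_at_right \<phi>_0)
  have "continuous_on {0..} \<phi>"
    unfolding continuous_on_eq_continuous_within
  proof
    fix y :: real assume "y \<in> {0..}"
    then show "continuous (at y within {0..}) \<phi>"
      using cont_0 DERIV_isCont[OF \<phi>_deriv[of y]]
      by (cases "y = 0") (auto intro: continuous_at_imp_continuous_within)
  qed
  moreover have "\<phi> differentiable_on {0<..}"
    unfolding differentiable_on_def using \<phi>_deriv
    by (metis differentiable_at_withinI greaterThan_iff real_differentiable_def)
  moreover have "0 \<le> deriv \<phi> y" if "0 < y" for y
  proof -
    have "d y \<le> d (\<phi> y)" "0 < d2 (\<phi> y)" "0 < \<phi> y"
      using that \<phi>_ge[OF that] by (auto intro: d_mono d2_pos)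
    then show ?thesis using \<alpha> DERIV_imp_deriv[OF \<phi>_deriv[OF that]] by simp
  qed
  ultimately have "reserve_function \<alpha> f \<phi>"
    unfolding reserve_function_def
    using \<phi>_nonneg \<phi>_0 \<phi>_ge DERIV_imp_deriv[OF \<phi>_deriv] by blast
  then show ?thesis by blast
qed

end

text \<open>Differentiability of \<open>deriv_nonneg f\<close> is the case \<open>n = 1\<close> of
  \<open>smooth_cost\<close>; at interior points the derivative within \<open>{0..}\<close> is the
  two-sided one.\<close>

lemma convex_costI:
  assumes "\<And>x. x \<ge> 0 \<Longrightarrow> f x \<ge> 0"
    and "smooth_cost f"
    and "\<And>x. x > 0 \<Longrightarrow> deriv_nonneg (deriv_nonneg f) x > 0"
    and "f 0 = 0" and "deriv_nonneg f 0 = 0"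
  shows "convex_cost f"
proof
  have vd: "(g has_real_derivative deriv_nonneg g x) (at x within {0..})"
    if "0 \<le> x" "g differentiable (at x within {0..})" for g x
  proof -
    have "g differentiable (at x within {0..})" by fact
    then have "(g has_vector_derivative vector_derivative g (at x within {0..})) (at x within {0..})"
      by (simp add: vector_derivative_works)
    then show ?thesis
      by (simp add: deriv_nonneg_def has_real_derivative_iff_has_vector_derivative)
  qed
  show "(f has_real_derivative deriv_nonneg f x) (at x within {0..})" if "0 \<le> x" for x
    using assms(2) that by (intro vd) (auto simp: smooth_cost_def differentiable_on_def)
  show "(deriv_nonneg f has_real_derivative deriv_nonneg (deriv_nonneg f) x) (at x)"
    if x: "0 < x" for x
  proof -
    have "(deriv_nonneg ^^ 1) f differentiable_on {0<..}"
      using assms(2) unfolding smooth_cost_def by blast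
    then have "deriv_nonneg f differentiable (at x within {0<..})"
      using x by (simp add: differentiable_on_def)
    then have "deriv_nonneg f differentiable (at x)"
      using x at_within_open[of x "{0<..}"] by simp
    then have "(deriv_nonneg f has_real_derivative deriv_nonneg (deriv_nonneg f) x) (at x within {0..})"
      using x by (intro vd) (auto dest: differentiable_at_withinI)
    then show ?thesis using x at_within_interior[of x "{0..}"] by simp
  qed
qed (use assms in auto)

theorem lemma1:
  fixes \<alpha> :: real and f :: "real \<Rightarrow> real"
  assumes "\<alpha> \<ge> 1"
    and "\<And>x. x \<ge> 0 \<Longrightarrow> f x \<ge> 0"
    and "mono_on {0..} f"
    and "smooth_cost f"
    and "strictly_convex_on {0..} f"
    and "\<And>x. x > 0 \<Longrightarrow> deriv_nonneg (deriv_nonneg f) x > 0"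
    and "f 0 = 0" and "deriv_nonneg f 0 = 0"
  shows "((\<exists>A :: 'm::finite arrival list \<Rightarrow> real ^ 'm. competitive \<alpha> f A)
            \<longleftrightarrow> (\<exists>\<phi>. reserve_function \<alpha> f \<phi>))
    \<and> (\<forall>\<phi>. reserve_function \<alpha> f \<phi> \<longrightarrow>
          (\<exists>A :: 'm arrival list \<Rightarrow> real ^ 'm. is_PUMax f \<phi> A) \<and>
          (\<forall>A :: 'm arrival list \<Rightarrow> real ^ 'm. is_PUMax f \<phi> A \<longrightarrow> competitive \<alpha> f A))"
proof -
  interpret convex_cost f using assms by (intro convex_costI)
  have reserve: "reserve f \<alpha> \<phi>" if "reserve_function \<alpha> f \<phi>" for \<phi>
    using that assms(1) by unfold_locales
  show ?thesis
    using reserve.ex_is_PUMax[OF reserve] reserve.is_PUMax_competitive[OF reserve]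
      ex_reserve_function[OF assms(1)] by blast
qed

end
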